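(* Let $F$ be a field with a derivation $x\mapsto x'$ and field of constants $C$, let $\bar F$ be the separable closure of $F$, and let $A$ be a finite-dimensional $C$-algebra whose automorphism scheme ${\rm G}={\rm Aut}_A$ is smooth. Fix a $C$-basis $\{e_1,\dots,e_n\}$ of $A$ and let $V$ be the column vector with entries $e_1\otimes 1,\dots,e_n\otimes 1\in A\otimes_C\bar F$. Let $f:{\rm Gal}(\bar F/F)\to {\rm G}(\bar F)$, $\sigma\mapsto f_\sigma$, be a $1$-cocycle representing a class in $H^1({\rm Gal}(\bar F/F),{\rm G}(\bar F))$, let $A_f$ be the corresponding form of $A$ over $F$, and let $P_f\in {\rm GL}_n(\bar F)$ be a matrix such that the entries of $P_f^{-1}V$ are invariant under the $f$-twisted action of ${\rm Gal}(\bar F/F)$ on $A\otimes_C\bar F$ and form an $F$-basis of $A_f$. Then there is a bijection from the set of all derivations of $A_f$ extending the derivation of $F$ to the set $$\{P_f^{-1}MP_f+(P_f^{-1})'P_f : M\in\mathfrak g_{\bar F}\}\cap {\rm M}_n(F).$$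
   Context: Algebras are associative with unit, not necessarily commutative. A derivation of a ring $R$ is an additive map $\delta:R\to R$ with $\delta(ab)=\delta(a)b+a\delta(b)$ for all $a,b\in R$; a constant is an element killed by the derivation. The derivation $x\mapsto x'$ of $F$ extends uniquely to $\bar F$, and the extension is again denoted by $'$; for $M=(m_{ij})\in {\rm M}_n(\bar F)$, $M'=(m_{ij}')$. A derivation $\delta$ of an $F$-algebra $B$ extends the derivation of $F$ if $\delta(x\cdot 1_B)=x'\cdot 1_B$ for all $x\in F$. The automorphism scheme ${\rm G}={\rm Aut}_A$ is the algebraic group scheme over $C$ sending a commutative $C$-algebra $S$ to the group ${\rm G}(S)$ of $S$-algebra automorphisms of $A\otimes_C S$. The Galois group acts on ${\rm G}(\bar F)$ by $\sigma(\phi)=({\rm id}\otimes\sigma)\circ\phi\circ({\rm id}\otimes\sigma)^{-1}$, and $1$-cocycles are continuous maps $f$ with $f_{\sigma\tau}=f_\sigma\,\sigma(f_\tau)$. A form of $A$ over $F$ is an $F$-algebra $B$ with $A\otimes_C\bar F\cong B\otimes_F\bar F$ as $\bar F$-algebras. The $f$-twisted action of ${\rm Gal}(\bar F/F)$ on $A\otimes_C\bar F$ is $(\sigma,a\otimes x)\mapsto f_\sigma(a\otimes\sigma x)$. The form $A_f$ corresponding to $f$ is the $F$-algebra of invariants of this action. $\mathfrak g_{\bar F}$ is the Lie algebra of the base change ${\rm G}_{\bar F}$, identified with the set of all $M\in {\rm M}_n(\bar F)$ such that the $\bar F$-linear map $\delta_M:A\otimes_C\bar F\to A\otimes_C\bar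 F$ given by $\delta_M(V)=MV$ (maps are applied entrywise to $V$) is a derivation of $A\otimes_C\bar F$. *)

theory Defs
  imports
    "HOL-Algebra.Subrings"
    "HOL-Algebra.Free_Abelian_Groups"
    "HOL-Analysis.Abstract_Topology"
    "Jordan_Normal_Form.VS_Connect"
    "Jordan_Normal_Form.Gauss_Jordan_Elimination"
begin

text \<open>
  Algebras over a commutative ring \<open>R\<close> are module records, so that the zero algebra is allowed and
  the base algebra may vary inside a definition. The locale \<open>algebra\<close> of HOL-Algebra is the
  commutative case.
\<close>

definition assoc_algebra :: "('r, 'x) ring_scheme \<Rightarrow> ('r, 'a, 'y) module_scheme \<Rightarrow> bool" where
  "assoc_algebra R B \<longleftrightarrow> Module.module R B \<and> Ring.ring B \<and>
     (\<forall>r\<in>carrier R. \<forall>x\<in>carrier B. \<forall>y\<in>carrier B.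
        (r \<odot>\<^bsub>B\<^esub> x) \<otimes>\<^bsub>B\<^esub> y = r \<odot>\<^bsub>B\<^esub> (x \<otimes>\<^bsub>B\<^esub> y) \<and>
        x \<otimes>\<^bsub>B\<^esub> (r \<odot>\<^bsub>B\<^esub> y) = r \<odot>\<^bsub>B\<^esub> (x \<otimes>\<^bsub>B\<^esub> y))"

definition derivation :: "('a, 'x) ring_scheme \<Rightarrow> ('a \<Rightarrow> 'a) \<Rightarrow> bool" where
  "derivation R \<delta> \<longleftrightarrow> \<delta> \<in> carrier R \<rightarrow> carrier R \<and>
     (\<forall>a\<in>carrier R. \<forall>b\<in>carrier R.
        \<delta> (a \<oplus>\<^bsub>R\<^esub> b) = \<delta> a \<oplus>\<^bsub>R\<^esub> \<delta> b \<and>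
        \<delta> (a \<otimes>\<^bsub>R\<^esub> b) = \<delta> a \<otimes>\<^bsub>R\<^esub> b \<oplus>\<^bsub>R\<^esub> a \<otimes>\<^bsub>R\<^esub> \<delta> b)"


section \<open>Tensor products of algebras\<close>

text \<open>
  The tensor product of \<open>R\<close>-algebras \<open>A\<close> and \<open>S\<close> (with \<open>S\<close> commutative) is the free abelian group
  on \<open>carrier A \<times> carrier S\<close> modulo the subgroup generated by the bilinearity and balancing
  relations, regarded as an \<open>S\<close>-algebra. Its elements are cosets. The operations on cosets
  are unions, over representatives, of the coset of the result; all these cosets agree.
\<close>

definition tensor_relations ::
  "('r, 'x) ring_scheme \<Rightarrow> ('r, 'a, 'y) module_scheme \<Rightarrow> ('r, 's, 'z) module_scheme
     \<Rightarrow> (('a \<times> 's) \<Rightarrow>\<^sub>0 int) set" where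
  "tensor_relations R A S =
     {frag_of (a \<oplus>\<^bsub>A\<^esub> b, s) - frag_of (a, s) - frag_of (b, s) | a b s.
        a \<in> carrier A \<and> b \<in> carrier A \<and> s \<in> carrier S} \<union>
     {frag_of (a, s \<oplus>\<^bsub>S\<^esub> t) - frag_of (a, s) - frag_of (a, t) | a s t.
        a \<in> carrier A \<and> s \<in> carrier S \<and> t \<in> carrier S} \<union>
     {frag_of (r \<odot>\<^bsub>A\<^esub> a, s) - frag_of (a, r \<odot>\<^bsub>S\<^esub> s) | r a s.
        r \<in> carrier R \<and> a \<in> carrier A \<and> s \<in> carrier S}"

definition tensor_null ::
  "('r, 'x) ring_scheme \<Rightarrow> ('r, 'a, 'y) module_scheme \<Rightarrow> ('r, 's, 'z) module_scheme
     \<Rightarrow> (('a \<times> 's) \<Rightarrow>\<^sub>0 int) set" where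
  "tensor_null R A S =
     generate (free_Abelian_group (carrier A \<times> carrier S)) (tensor_relations R A S)"

definition tensor_class ::
  "('r, 'x) ring_scheme \<Rightarrow> ('r, 'a, 'y) module_scheme \<Rightarrow> ('r, 's, 'z) module_scheme
     \<Rightarrow> (('a \<times> 's) \<Rightarrow>\<^sub>0 int) \<Rightarrow> (('a \<times> 's) \<Rightarrow>\<^sub>0 int) set" where
  "tensor_class R A S x =
     tensor_null R A S #>\<^bsub>free_Abelian_group (carrier A \<times> carrier S)\<^esub> x"

definition pure_tensor ::
  "('r, 'x) ring_scheme \<Rightarrow> ('r, 'a, 'y) module_scheme \<Rightarrow> ('r, 's, 'z) module_scheme
     \<Rightarrow> 'a \<Rightarrow> 's \<Rightarrow> (('a \<times> 's) \<Rightarrow>\<^sub>0 int) set" where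
  "pure_tensor R A S a s = tensor_class R A S (frag_of (a, s))"

text \<open>The biadditive extension of \<open>(a, s) (b, t) = (a b, s t)\<close> to formal sums.\<close>

definition formal_mult ::
  "('a, 'y) ring_scheme \<Rightarrow> ('s, 'z) ring_scheme
     \<Rightarrow> (('a \<times> 's) \<Rightarrow>\<^sub>0 int) \<Rightarrow> (('a \<times> 's) \<Rightarrow>\<^sub>0 int) \<Rightarrow> (('a \<times> 's) \<Rightarrow>\<^sub>0 int)" where
  "formal_mult A S x y =
     frag_extend (\<lambda>(a, s). frag_extend (\<lambda>(b, t). frag_of (a \<otimes>\<^bsub>A\<^esub> b, s \<otimes>\<^bsub>S\<^esub> t)) y) x"

definition tensor_algebra ::
  "('r, 'x) ring_scheme \<Rightarrow> ('r, 'a, 'y) module_scheme \<Rightarrow> ('r, 's, 'z) module_scheme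
     \<Rightarrow> ('s, (('a \<times> 's) \<Rightarrow>\<^sub>0 int) set) module" where
  "tensor_algebra R A S =
     \<lparr>carrier = rcosets\<^bsub>free_Abelian_group (carrier A \<times> carrier S)\<^esub> (tensor_null R A S),
      mult = (\<lambda>X Y. \<Union>x\<in>X. \<Union>y\<in>Y. tensor_class R A S (formal_mult A S x y)),
      one = pure_tensor R A S \<one>\<^bsub>A\<^esub> \<one>\<^bsub>S\<^esub>,
      ring.zero = tensor_null R A S,
      add = (\<lambda>X Y. X <#>\<^bsub>free_Abelian_group (carrier A \<times> carrier S)\<^esub> Y),
      smult = (\<lambda>t X. \<Union>x\<in>X. tensor_class R A S
                 (frag_extend (\<lambda>(a, s). frag_of (a, t \<otimes>\<^bsub>S\<^esub> s)) x))\<rparr>"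

text \<open>The map \<open>id \<otimes> h\<close> induced by a homomorphism \<open>h\<close> of \<open>R\<close>-algebras from \<open>S\<close> to \<open>S'\<close>.\<close>

definition tensor_map ::
  "('r, 'x) ring_scheme \<Rightarrow> ('r, 'a, 'y) module_scheme \<Rightarrow> ('r, 's, 'z) module_scheme
     \<Rightarrow> ('r, 't, 'w) module_scheme \<Rightarrow> ('s \<Rightarrow> 't)
     \<Rightarrow> (('a \<times> 's) \<Rightarrow>\<^sub>0 int) set \<Rightarrow> (('a \<times> 't) \<Rightarrow>\<^sub>0 int) set" where
  "tensor_map R A S S' h X =
     (\<Union>x\<in>X. tensor_class R A S' (frag_extend (\<lambda>(a, s). frag_of (a, h s)) x))"


section \<open>The automorphism scheme\<close>

text \<open>Automorphisms are extensional functions, so that equal automorphisms are equal in HOL.\<close>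

definition aut_points ::
  "('r, 'x) ring_scheme \<Rightarrow> ('r, 'a, 'y) module_scheme \<Rightarrow> ('r, 's, 'z) module_scheme
     \<Rightarrow> ((('a \<times> 's) \<Rightarrow>\<^sub>0 int) set \<Rightarrow> (('a \<times> 's) \<Rightarrow>\<^sub>0 int) set) set" where
  "aut_points R A S =
     {\<phi> \<in> extensional (carrier (tensor_algebra R A S)).
        \<phi> \<in> ring_iso (tensor_algebra R A S) (tensor_algebra R A S) \<and>
        \<phi> \<in> module_hom S (tensor_algebra R A S) (tensor_algebra R A S)}"

text \<open>
  Smoothness of the functor \<open>S \<mapsto> aut_points R A S\<close> is the infinitesimal lifting property: for every
  surjection \<open>\<pi>\<close> from \<open>S\<close> to \<open>S'\<close> of commutative \<open>R\<close>-algebras whose kernel has square zero, all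
  \<open>S'\<close>-points lift to \<open>S\<close>-points. For \<open>A\<close> finite-dimensional over a field \<open>R\<close> the functor is
  represented by a closed subscheme of \<open>GL\<^sub>n\<close>, so the finite presentation that smoothness also
  requires is automatic; moreover the lifting property follows from the single case
  \<open>R[x]/I\<^sup>2 \<rightarrow> R[x]/I\<close>, where \<open>R[x]/I\<close> is the coordinate ring. Hence it is enough to test on algebras
  whose carrier lies in a type \<open>'s\<close> that is infinite and at least as large as \<open>R\<close>.
\<close>

definition smooth_aut_scheme ::
  "'s itself \<Rightarrow> ('r, 'x) ring_scheme \<Rightarrow> ('r, 'a, 'y) module_scheme \<Rightarrow> bool" where
  "smooth_aut_scheme (_ :: 's itself) R A \<longleftrightarrow>
     (\<forall>(S :: ('r, 's) module) (S' :: ('r, 's) module) \<pi>.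
        algebra R S \<and> algebra R S' \<and> \<pi> \<in> Ring.ring_hom S S' \<and> \<pi> \<in> module_hom R S S' \<and>
        \<pi> ` carrier S = carrier S' \<and>
        (\<forall>x\<in>a_kernel S S' \<pi>. \<forall>y\<in>a_kernel S S' \<pi>. x \<otimes>\<^bsub>S\<^esub> y = \<zero>\<^bsub>S\<^esub>) \<longrightarrow>
        (\<forall>\<psi>\<in>aut_points R A S'. \<exists>\<phi>\<in>aut_points R A S. \<forall>z\<in>carrier (tensor_algebra R A S).
           tensor_map R A S S' \<pi> (\<phi> z) = \<psi> (tensor_map R A S S' \<pi> z)))"


section \<open>The separable closure and its Galois group\<close>

text \<open>
  The separable closure is the whole of the type \<open>'k\<close>, and \<open>F\<close> and its field of constants \<open>C\<close> are
  subsets of it.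
\<close>

abbreviation subfield_ring :: "'k::field set \<Rightarrow> 'k ring" where
  "subfield_ring L \<equiv> class_ring\<lparr>carrier := L\<rparr>"

definition class_algebra :: "('k::field, 'k) module" where
  "class_algebra =
     \<lparr>carrier = UNIV, mult = (*), one = 1, ring.zero = 0, add = (+), smult = (*)\<rparr>"

definition separable_poly :: "'k::field poly \<Rightarrow> bool" where
  "separable_poly p \<longleftrightarrow> coprime p (pderiv p)"

definition minimal_poly_over :: "'k::field set \<Rightarrow> 'k \<Rightarrow> 'k poly \<Rightarrow> bool" where
  "minimal_poly_over F x p \<longleftrightarrow>
     (\<forall>i. coeff p i \<in> F) \<and> lead_coeff p = 1 \<and> poly p x = 0 \<and>
     (\<forall>q. (\<forall>i. coeff q i \<in> F) \<and> q \<noteq> 0 \<and> poly q x = 0 \<longrightarrow> degree p \<le> degree q)"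

definition separable_closure_of :: "'k::field set \<Rightarrow> bool" where
  "separable_closure_of F \<longleftrightarrow>
     (\<forall>x::'k. \<exists>p. minimal_poly_over F x p \<and> separable_poly p) \<and>
     (\<forall>p::'k poly. degree p > 0 \<and> separable_poly p \<longrightarrow> (\<exists>x. poly p x = 0))"

definition galois_group :: "'k::field set \<Rightarrow> ('k \<Rightarrow> 'k) set" where
  "galois_group L = {\<sigma> \<in> ring_iso class_ring class_ring. \<forall>x\<in>L. \<sigma> x = x}"

definition finite_subextension :: "'k::field set \<Rightarrow> 'k set \<Rightarrow> bool" where
  "finite_subextension F L \<longleftrightarrow> subfield L class_ring \<and> F \<subseteq> L \<and>
     vectorspace.fin_dim (subfield_ring F) (class_algebra\<lparr>carrier := L\<rparr>)"

definition krull_topology :: "'k::field set \<Rightarrow> ('k \<Rightarrow> 'k) topology" where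
  "krull_topology F =
     topology_generated_by
       {(\<lambda>\<tau>. \<sigma> \<circ> \<tau>) ` galois_group L | \<sigma> L. \<sigma> \<in> galois_group F \<and> finite_subextension F L}"


section \<open>Cocycles and twisted forms\<close>

abbreviation scalar_ext ::
  "'k::field set \<Rightarrow> ('k, 'a) module \<Rightarrow> ('k, (('a \<times> 'k) \<Rightarrow>\<^sub>0 int) set) module" where
  "scalar_ext C A \<equiv> tensor_algebra (subfield_ring C) A class_algebra"

definition galois_act ::
  "'k::field set \<Rightarrow> ('k, 'a) module \<Rightarrow> ('k \<Rightarrow> 'k)
     \<Rightarrow> (('a \<times> 'k) \<Rightarrow>\<^sub>0 int) set \<Rightarrow> (('a \<times> 'k) \<Rightarrow>\<^sub>0 int) set" where
  "galois_act C A \<sigma> = tensor_map (subfield_ring C) A class_algebra class_algebra \<sigma>"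

definition galois_act_aut ::
  "'k::field set \<Rightarrow> ('k, 'a) module \<Rightarrow> ('k \<Rightarrow> 'k)
     \<Rightarrow> ((('a \<times> 'k) \<Rightarrow>\<^sub>0 int) set \<Rightarrow> (('a \<times> 'k) \<Rightarrow>\<^sub>0 int) set)
     \<Rightarrow> ((('a \<times> 'k) \<Rightarrow>\<^sub>0 int) set \<Rightarrow> (('a \<times> 'k) \<Rightarrow>\<^sub>0 int) set)" where
  "galois_act_aut C A \<sigma> \<phi> =
     restrict (galois_act C A \<sigma> \<circ> \<phi> \<circ> inv_into (carrier (scalar_ext C A)) (galois_act C A \<sigma>))
       (carrier (scalar_ext C A))"

definition one_cocycle ::
  "'k::field set \<Rightarrow> 'k set \<Rightarrow> ('k, 'a) module
     \<Rightarrow> (('k \<Rightarrow> 'k) \<Rightarrow> (('a \<times> 'k) \<Rightarrow>\<^sub>0 int) set \<Rightarrow> (('a \<times> 'k) \<Rightarrow>\<^sub>0 int) set) \<Rightarrow> bool" where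
  "one_cocycle F C A f \<longleftrightarrow>
     f \<in> galois_group F \<rightarrow> aut_points (subfield_ring C) A class_algebra \<and>
     continuous_map (krull_topology F)
       (discrete_topology (aut_points (subfield_ring C) A class_algebra)) f \<and>
     (\<forall>\<sigma>\<in>galois_group F. \<forall>\<tau>\<in>galois_group F.
        f (\<sigma> \<circ> \<tau>) = compose (carrier (scalar_ext C A)) (f \<sigma>) (galois_act_aut C A \<sigma> (f \<tau>)))"

text \<open>Over \<open>subfield_ring F\<close>, the record below is the \<open>F\<close>-algebra of invariants.\<close>

definition twisted_form ::
  "'k::field set \<Rightarrow> 'k set \<Rightarrow> ('k, 'a) module
     \<Rightarrow> (('k \<Rightarrow> 'k) \<Rightarrow> (('a \<times> 'k) \<Rightarrow>\<^sub>0 int) set \<Rightarrow> (('a \<times> 'k) \<Rightarrow>\<^sub>0 int) set)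
     \<Rightarrow> ('k, (('a \<times> 'k) \<Rightarrow>\<^sub>0 int) set) module" where
  "twisted_form F C A f =
     (scalar_ext C A)\<lparr>carrier :=
        {z \<in> carrier (scalar_ext C A). \<forall>\<sigma>\<in>galois_group F. f \<sigma> (galois_act C A \<sigma> z) = z}\<rparr>"


section \<open>Bases, matrices and derivations\<close>

definition indexed_basis ::
  "('r, 'x) ring_scheme \<Rightarrow> ('r, 'b, 'y) module_scheme \<Rightarrow> nat \<Rightarrow> (nat \<Rightarrow> 'b) \<Rightarrow> bool" where
  "indexed_basis R B n b \<longleftrightarrow> inj_on b {..<n} \<and> vectorspace.basis R B (b ` {..<n})"

text \<open>Indices run from \<open>0\<close> to \<open>n - 1\<close>. This is the \<open>i\<close>-th entry of the product of \<open>M\<close> with the column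
  \<open>(v 0, \<dots>, v (n - 1))\<close>.\<close>

definition mat_column ::
  "('k, 'b, 'y) module_scheme \<Rightarrow> nat \<Rightarrow> 'k mat \<Rightarrow> (nat \<Rightarrow> 'b) \<Rightarrow> nat \<Rightarrow> 'b" where
  "mat_column B n M v i = (\<Oplus>\<^bsub>B\<^esub> j \<in> {..<n}. (M $$ (i, j)) \<odot>\<^bsub>B\<^esub> v j)"

abbreviation mat_inv :: "'k::field mat \<Rightarrow> 'k mat" where
  "mat_inv P \<equiv> the (mat_inverse P)"

definition basis_column ::
  "'k::field set \<Rightarrow> ('k, 'a) module \<Rightarrow> (nat \<Rightarrow> 'a) \<Rightarrow> nat \<Rightarrow> (('a \<times> 'k) \<Rightarrow>\<^sub>0 int) set" where
  "basis_column C A e i = pure_tensor (subfield_ring C) A class_algebra (e i) 1"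

text \<open>
  The Lie algebra of the automorphism scheme base changed to the separable closure, as the set of
  matrices \<open>M\<close> for which the linear map sending the basis column \<open>V\<close> to \<open>M V\<close> is a derivation. That
  map is unique on the carrier, since the entries of \<open>V\<close> span.
\<close>

definition lie_algebra ::
  "'k::field set \<Rightarrow> ('k, 'a) module \<Rightarrow> nat \<Rightarrow> (nat \<Rightarrow> 'a) \<Rightarrow> 'k mat set" where
  "lie_algebra C A n e =
     {M \<in> carrier_mat n n. \<exists>\<delta> \<in> module_hom class_ring (scalar_ext C A) (scalar_ext C A).
        (\<forall>i<n. \<delta> (basis_column C A e i) = mat_column (scalar_ext C A) n M (basis_column C A e) i) \<and>
        derivation (scalar_ext C A) \<delta>}"

definition derivations_extending ::
  "'k set \<Rightarrow> ('k \<Rightarrow> 'k) \<Rightarrow> ('k, 'b, 'y) module_scheme \<Rightarrow> ('b \<Rightarrow> 'b) set" where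
  "derivations_extending F d B =
     {\<delta> \<in> extensional (carrier B). derivation B \<delta> \<and>
        (\<forall>x\<in>F. \<delta> (x \<odot>\<^bsub>B\<^esub> \<one>\<^bsub>B\<^esub>) = d x \<odot>\<^bsub>B\<^esub> \<one>\<^bsub>B\<^esub>)}"

end

theory Submission
  imports Defs
begin

text \<open>
  Write \<open>T\<close> for the scalar extension and \<open>W = P\<^sup>-\<^sup>1 V\<close>. A derivation \<open>\<delta>\<close> of the form is
  determined by the matrix \<open>N\<close> over \<open>F\<close> with \<open>\<delta> W = N W\<close>. As \<open>W\<close> is also a basis of \<open>T\<close>, \<open>\<delta>\<close>
  extends uniquely to a derivation of \<open>T\<close> that is semilinear along \<open>D\<close>. Another such derivation is
  \<open>id \<otimes> D\<close>, which kills \<open>V\<close>, so the two differ by a linear derivation, that is, by an element \<open>M\<close>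
  of the Lie algebra. Comparing values on \<open>W\<close> gives \<open>N = P\<^sup>-\<^sup>1 M P + (P\<^sup>-\<^sup>1)' P\<close>. Conversely, the
  semilinear derivation obtained from \<open>M\<close> preserves the \<open>F\<close>-span of \<open>W\<close> as soon as \<open>N\<close> has
  entries in \<open>F\<close>.
\<close>

section \<open>Tensor products\<close>

text \<open>Two coordinate systems on \<open>T\<close> do different work. In \<open>W\<close> the
  form is the set of elements with coordinates in \<open>F\<close>, so the extension of a derivation
  is given by a formula in coordinates and nothing has to be checked for it to be well defined. The
  Leibniz rule is the price: it is verified on scalar multiples of elements of the form, which
  generate \<open>T\<close> additively. In \<open>V\<close> the behaviour of
  \<open>id \<otimes> D\<close> is trivial, since \<open>D 1 = 0\<close>. This map exists because
  \<open>D\<close> kills \<open>C\<close>, hence is \<open>C\<close>-linear and respects the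
  balancing relations. That \<open>W\<close> is a basis of \<open>T\<close> rests on
  \<open>V\<close> being one. Spanning is immediate, but independence needs additive maps out of a
  quotient of a free abelian group, and these come from the universal property. As the operations on
  the quotient are unions over representatives, each of them must first be shown to be independent
  of the representatives.\<close>

lemma frag_extend_fun_add:
  "frag_extend (\<lambda>p. f p + g p) x = frag_extend f x + frag_extend g x"
  by (simp add: frag_extend_def frag_cmul_distrib2 sum.distrib)

lemma frag_extend_fun_diff:
  "frag_extend (\<lambda>p. f p - g p) x = frag_extend f x - frag_extend g x"
  using frag_extend_fun_add[of "\<lambda>p. f p - g p" g x] by simp

lemma keys_frag_extend_subset:
  assumes "Poly_Mapping.keys x \<subseteq> X" and "\<And>p. p \<in> X \<Longrightarrow> Poly_Mapping.keys (b p) \<subseteq> Y"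
  shows "Poly_Mapping.keys (frag_extend b x) \<subseteq> Y"
  using keys_frag_extend[of b x] assms by blast

lemma formal_mult_of:
  "formal_mult A S (frag_of (a, s)) (frag_of (b, t)) = frag_of (a \<otimes>\<^bsub>A\<^esub> b, s \<otimes>\<^bsub>S\<^esub> t)"
  by (simp add: formal_mult_def)

lemma formal_mult_add_left: "formal_mult A S (x + y) z = formal_mult A S x z + formal_mult A S y z"
  by (simp add: formal_mult_def frag_extend_add)

lemma formal_mult_diff_left: "formal_mult A S (x - y) z = formal_mult A S x z - formal_mult A S y z"
  by (simp add: formal_mult_def frag_extend_diff)

text \<open>The second argument sits inside the generator map of the outer
  \<open>frag_extend\<close>, so \<open>frag_extend\<close> must also be additive in its function
  argument.\<close>

lemma formal_mult_add_right: "formal_mult A S z (x + y) = formal_mult A S z x + formal_mult A S z y"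
  by (simp add: formal_mult_def frag_extend_add frag_extend_fun_add case_prod_unfold)

lemma formal_mult_diff_right: "formal_mult A S z (x - y) = formal_mult A S z x - formal_mult A S z y"
  by (simp add: formal_mult_def frag_extend_diff frag_extend_fun_diff case_prod_unfold)

lemma formal_mult_zero [simp]: "formal_mult A S 0 x = 0" "formal_mult A S x 0 = 0"
  using formal_mult_diff_left[of A S 0 0 x] formal_mult_diff_right[of A S x 0 0] by simp_all

section \<open>The tensor product as an algebra, and its universal property\<close>

locale tensor_product =
  fixes R :: "('r, 'x) ring_scheme" and A :: "('r, 'a, 'y) module_scheme"
    and S :: "('r, 's, 'z) module_scheme"
  assumes assoc_algebra_A: "assoc_algebra R A" and algebra_S: "algebra R S"
begin

abbreviation "G \<equiv> free_Abelian_group (carrier A \<times> carrier S)"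
abbreviation "N \<equiv> tensor_null R A S"
abbreviation "T \<equiv> tensor_algebra R A S"
abbreviation "cls \<equiv> tensor_class R A S"
abbreviation "pt \<equiv> pure_tensor R A S"

sublocale A: ring A using assoc_algebra_A by (simp add: assoc_algebra_def)
sublocale AM: Module.module R A using assoc_algebra_A by (simp add: assoc_algebra_def)
sublocale S: algebra R S by (fact algebra_S)
sublocale G: comm_group G by (rule abelian_free_Abelian_group)

lemma smult_mult_A:
  assumes "r \<in> carrier R" "a \<in> carrier A" "b \<in> carrier A"
  shows "(r \<odot>\<^bsub>A\<^esub> a) \<otimes>\<^bsub>A\<^esub> b = r \<odot>\<^bsub>A\<^esub> (a \<otimes>\<^bsub>A\<^esub> b)" "a \<otimes>\<^bsub>A\<^esub> (r \<odot>\<^bsub>A\<^esub> b) = r \<odot>\<^bsub>A\<^esub> (a \<otimes>\<^bsub>A\<^esub> b)"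
  using assoc_algebra_A assms by (simp_all add: assoc_algebra_def)

lemma tensor_relations_subset: "tensor_relations R A S \<subseteq> carrier G"
proof -
  have "Poly_Mapping.keys (frag_of p - frag_of q - frag_of r) \<subseteq> {p, q, r}"
       "Poly_Mapping.keys (frag_of p - frag_of q) \<subseteq> {p, q}" for p q r :: "'a \<times> 's"
    by (auto dest!: subsetD[OF keys_diff] simp: keys_frag_of split: if_splits)
  note * = order_trans[OF this(1)] order_trans[OF this(2)]
  show ?thesis
    unfolding tensor_relations_def by (auto 0 0 simp del: keys_single intro!: *)
qed

lemma subgroup_null: "subgroup N G"
  unfolding tensor_null_def by (rule G.generate_is_subgroup[OF tensor_relations_subset])

lemma normal_null: "N \<lhd> G"
  by (rule G.subgroup_imp_normal[OF subgroup_null])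

lemma null_subset: "x \<in> N \<Longrightarrow> Poly_Mapping.keys x \<subseteq> carrier A \<times> carrier S"
  using subgroup.mem_carrier[OF subgroup_null, of x] by (simp only: carrier_free_Abelian_group_iff)

lemma frag_extend_closed:
  assumes "x \<in> carrier G" and "\<And>a s. a \<in> carrier A \<Longrightarrow> s \<in> carrier S \<Longrightarrow> b (a, s) \<in> carrier (free_Abelian_group Y)"
  shows "frag_extend b x \<in> carrier (free_Abelian_group Y)"
  using assms keys_frag_extend_subset[of x "carrier A \<times> carrier S" b Y] by auto

lemma null_add: "x \<in> N \<Longrightarrow> y \<in> N \<Longrightarrow> x + y \<in> N"
  using subgroup.m_closed[OF subgroup_null, of x y] by simp

lemma null_uminus: "x \<in> N \<Longrightarrow> - x \<in> N"
  using subgroup.m_inv_closed[OF subgroup_null, of x] null_subset[of x] by simp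

lemma null_diff: "x \<in> N \<Longrightarrow> y \<in> N \<Longrightarrow> x - y \<in> N"
  using null_add[OF _ null_uminus] by force

lemma null_zero: "0 \<in> N"
  using subgroup.one_closed[OF subgroup_null] by simp

lemma null_relations:
  "a \<in> carrier A \<Longrightarrow> b \<in> carrier A \<Longrightarrow> s \<in> carrier S \<Longrightarrow>
     frag_of (a \<oplus>\<^bsub>A\<^esub> b, s) - frag_of (a, s) - frag_of (b, s) \<in> N"
  "a \<in> carrier A \<Longrightarrow> s \<in> carrier S \<Longrightarrow> t \<in> carrier S \<Longrightarrow>
     frag_of (a, s \<oplus>\<^bsub>S\<^esub> t) - frag_of (a, s) - frag_of (a, t) \<in> N"
  "r \<in> carrier R \<Longrightarrow> a \<in> carrier A \<Longrightarrow> s \<in> carrier S \<Longrightarrow>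
     frag_of (r \<odot>\<^bsub>A\<^esub> a, s) - frag_of (a, r \<odot>\<^bsub>S\<^esub> s) \<in> N"
  unfolding tensor_null_def
  by (rule generate.incl; unfold tensor_relations_def; blast)+

text \<open>Differences replace the subgroup cases of \<open>generate\<close>: -h is 0 - h, and h1 +
  h2 is h1 - (0 - h2). A single closure case then suffices.\<close>

lemma null_induct [consumes 1, case_names add_left add_right balanced diff]:
  assumes "x \<in> N"
    and "\<And>a b s. a \<in> carrier A \<Longrightarrow> b \<in> carrier A \<Longrightarrow> s \<in> carrier S \<Longrightarrow>
      Q (frag_of (a \<oplus>\<^bsub>A\<^esub> b, s) - frag_of (a, s) - frag_of (b, s))"
    and "\<And>a s t. a \<in> carrier A \<Longrightarrow> s \<in> carrier S \<Longrightarrow> t \<in> carrier S \<Longrightarrow>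
      Q (frag_of (a, s \<oplus>\<^bsub>S\<^esub> t) - frag_of (a, s) - frag_of (a, t))"
    and "\<And>r a s. r \<in> carrier R \<Longrightarrow> a \<in> carrier A \<Longrightarrow> s \<in> carrier S \<Longrightarrow>
      Q (frag_of (r \<odot>\<^bsub>A\<^esub> a, s) - frag_of (a, r \<odot>\<^bsub>S\<^esub> s))"
    and "\<And>x y. x \<in> N \<Longrightarrow> y \<in> N \<Longrightarrow> Q x \<Longrightarrow> Q y \<Longrightarrow> Q (x - y)"
  shows "Q x"
proof -
  have rel: "Q x" if "x \<in> tensor_relations R A S" for x
    using that unfolding tensor_relations_def
    by (elim UnE CollectE exE conjE; simp only: assms(2-4))
  \<comment> \<open>There is no case for 0, so \<open>Q 0\<close> comes from a relation minus
    itself, taken at the zero elements because these certainly lie in the carriers.\<close>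
  note zero = A.zero_closed A.zero_closed S.zero_closed
  have Q0: "Q 0"
    using assms(5)[OF null_relations(1) null_relations(1) assms(2) assms(2), OF zero zero zero zero]
    by (simp only: diff_self)
  have "x \<in> N \<and> Q x"
    using assms(1) unfolding tensor_null_def
  proof (induction rule: generate.induct)
    case one
    show ?case using Q0 null_zero by (simp add: tensor_null_def)
  next
    case (incl h)
    then show ?case by (simp add: generate.incl rel)
  next
    case (inv h)
    then have "h \<in> N"
      by (simp add: tensor_null_def generate.incl)
    then show ?case
      using null_subset[of h] assms(5)[OF null_zero \<open>h \<in> N\<close> Q0 rel[OF inv]] null_uminus[of h] by (simp add: tensor_null_def)
  next
    case (eng h1 h2)
    then have "h1 \<in> N" "h2 \<in> N" "Q h1" "Q h2" by (auto simp: tensor_null_def)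
    then have "Q (h1 - (0 - h2))"
      using assms(5) Q0 null_zero null_diff by blast
    then show ?case using \<open>h1 \<in> N\<close> \<open>h2 \<in> N\<close> null_add by (simp add: tensor_null_def)
  qed
  then show ?thesis by blast
qed

lemma cls_closed: "x \<in> carrier G \<Longrightarrow> cls x \<in> carrier T"
  using G.rcosetsI[OF subgroup.subset[OF subgroup_null]]
  by (simp add: tensor_algebra_def tensor_class_def)

lemma cls_cases:
  assumes "z \<in> carrier T"
  obtains x where "x \<in> carrier G" "z = cls x"
  using assms unfolding tensor_algebra_def tensor_class_def RCOSETS_def by auto

lemma mem_cls_iff: "x \<in> carrier G \<Longrightarrow> y \<in> cls x \<longleftrightarrow> y \<in> carrier G \<and> y - x \<in> N"
proof -
  assume x: "x \<in> carrier G"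
  have "y \<in> carrier G" if "y \<in> cls x"
    using subgroup.elemrcos_carrier[OF subgroup_null G.is_group x] that by (simp add: tensor_class_def)
  then show ?thesis
    using subgroup.rcos_module[OF subgroup_null G.is_group x, of y] x
    by (auto simp: tensor_class_def)
qed

lemma cls_eq_iff: "x \<in> carrier G \<Longrightarrow> y \<in> carrier G \<Longrightarrow> cls x = cls y \<longleftrightarrow> x - y \<in> N"
proof
  assume *: "x \<in> carrier G" "y \<in> carrier G"
  { assume "cls x = cls y"
    moreover have "x \<in> cls x" using * null_zero by (simp only: mem_cls_iff) simp
    ultimately show "x - y \<in> N" using * by (simp only: mem_cls_iff) }
  { assume "x - y \<in> N"
    then have "x \<in> cls y" using * by (simp only: mem_cls_iff)
    then show "cls x = cls y"
      using G.repr_independence[OF _ *(2) subgroup_null, of x] by (simp add: tensor_class_def) }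
qed

lemma cls_add: "x \<in> carrier G \<Longrightarrow> y \<in> carrier G \<Longrightarrow> cls x \<oplus>\<^bsub>T\<^esub> cls y = cls (x + y)"
  using normal.rcos_sum[OF normal_null, of x y] by (simp add: tensor_algebra_def tensor_class_def)

lemma zero_eq_cls: "\<zero>\<^bsub>T\<^esub> = cls 0"
  using subgroup.rcos_const[OF subgroup_null G.is_group null_zero]
  by (simp add: tensor_algebra_def tensor_class_def)

text \<open>The operations of \<open>tensor_algebra\<close> are unions over the representatives of a
  coset; independence of the representative collapses such a union to one value.\<close>

lemma UN_cls:
  assumes "x \<in> carrier G" and "\<And>y. y \<in> carrier G \<Longrightarrow> y - x \<in> N \<Longrightarrow> g y = g x"
  shows "(\<Union>y\<in>cls x. g y) = g x"
proof -
  have "x \<in> cls x" using assms(1) null_zero by (simp only: mem_cls_iff) simp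
  moreover have "g y = g x" if "y \<in> cls x" for y
    using that assms mem_cls_iff by blast
  ultimately show ?thesis by blast
qed

lemma formal_mult_closed: "x \<in> carrier G \<Longrightarrow> y \<in> carrier G \<Longrightarrow> formal_mult A S x y \<in> carrier G"
  unfolding formal_mult_def
  by (rule frag_extend_closed, assumption, simp only: prod.case, rule frag_extend_closed) auto

text \<open>The null subgroup absorbs formal products from both sides, which makes the product of
  cosets well defined. Biadditivity reduces the other factor to a single generator, and a generator
  sends each defining relation to one of the same kind.\<close>

lemma formal_mult_null:
  assumes "x \<in> N" "y \<in> carrier G"
  shows "formal_mult A S x y \<in> N" "formal_mult A S y x \<in> N"
proof -
  have y: "Poly_Mapping.keys y \<subseteq> carrier A \<times> carrier S" using assms(2) by simp
  show "formal_mult A S x y \<in> N"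
    using y
  proof (induction y rule: free_Abelian_group_induct[consumes 1, case_names zero diff of])
    case (of p)
    obtain b t where p: "p = (b, t)" "b \<in> carrier A" "t \<in> carrier S" using of by auto
    from assms(1) show ?case unfolding p
      by (induction rule: null_induct)
        (use p in \<open>simp_all add: formal_mult_diff_left formal_mult_of A.l_distr S.l_distr
          smult_mult_A S.smult_assoc2 null_relations null_diff\<close>)
  qed (simp_all add: null_zero formal_mult_diff_right null_diff)
  show "formal_mult A S y x \<in> N"
    using y
  proof (induction y rule: free_Abelian_group_induct[consumes 1, case_names zero diff of])
    case (of p)
    obtain b t where p: "p = (b, t)" "b \<in> carrier A" "t \<in> carrier S" using of by auto
    \<comment> \<open>Moving \<open>r\<close> past \<open>t\<close> uses that \<open>S\<close> is
      commutative.\<close>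
    have *: "t \<otimes>\<^bsub>S\<^esub> (r \<odot>\<^bsub>S\<^esub> s) = r \<odot>\<^bsub>S\<^esub> (t \<otimes>\<^bsub>S\<^esub> s)" if "r \<in> carrier R" "s \<in> carrier S" for r s
      using that p S.smult_assoc2[of r s t] by (simp add: S.m_comm)
    from assms(1) show ?case unfolding p
      by (induction rule: null_induct)
        (use p in \<open>simp_all add: formal_mult_diff_right formal_mult_of A.r_distr S.r_distr
          smult_mult_A * null_relations null_diff\<close>)
  qed (simp_all add: null_zero formal_mult_diff_left null_diff)
qed

lemma cls_mult:
  assumes "x \<in> carrier G" "y \<in> carrier G"
  shows "cls x \<otimes>\<^bsub>T\<^esub> cls y = cls (formal_mult A S x y)"
proof -
  have *: "cls (formal_mult A S x' y') = cls (formal_mult A S x y)"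
    if "x' \<in> carrier G" "x' - x \<in> N" "y' \<in> carrier G" "y' - y \<in> N" for x' y'
  proof -
    \<comment> \<open>This is x'y' - xy, split so that each summand has a null factor.\<close>
    have "formal_mult A S (x' - x) y' + formal_mult A S x (y' - y) \<in> N"
      using that assms by (intro null_add formal_mult_null)
    then show ?thesis
      using that assms formal_mult_closed
      by (simp only: cls_eq_iff) (simp add: formal_mult_diff_left formal_mult_diff_right)
  qed
  have "(\<Union>y'\<in>cls y. cls (formal_mult A S x' y')) = cls (formal_mult A S x y)"
    if "x' \<in> carrier G" "x' - x \<in> N" for x'
    using UN_cls[OF assms(2), of "\<lambda>y'. cls (formal_mult A S x' y')"] *[OF that, of y] *[OF that]
      null_zero assms by simp
  moreover have "x - x \<in> N" using null_zero by simp
  ultimately show ?thesis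
    unfolding tensor_algebra_def
    using UN_cls[OF assms(1), of "\<lambda>x'. \<Union>y'\<in>cls y. cls (formal_mult A S x' y')"] assms
    by simp
qed

lemma cls_smult:
  assumes t: "t \<in> carrier S" and x: "x \<in> carrier G"
  shows "t \<odot>\<^bsub>T\<^esub> cls x = cls (frag_extend (\<lambda>(a, s). frag_of (a, t \<otimes>\<^bsub>S\<^esub> s)) x)" (is "_ = cls (?h x)")
proof -
  have closed: "?h y \<in> carrier G" if "y \<in> carrier G" for y
    using that t by (intro frag_extend_closed) auto
  have comm: "t \<otimes>\<^bsub>S\<^esub> (r \<odot>\<^bsub>S\<^esub> s) = r \<odot>\<^bsub>S\<^esub> (t \<otimes>\<^bsub>S\<^esub> s)" if "r \<in> carrier R" "s \<in> carrier S" for r s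
    using that t S.smult_assoc2[of r s t] by (simp add: S.m_comm)
  have null: "?h y \<in> N" if "y \<in> N" for y
    using that
    by (induction rule: null_induct)
      (simp_all add: frag_extend_diff t null_diff null_relations S.r_distr comm)
  have "cls (?h y) = cls (?h x)" if "y \<in> carrier G" "y - x \<in> N" for y
    using null[OF that(2)] closed that(1) x by (simp only: cls_eq_iff frag_extend_diff)
  then show ?thesis
    using UN_cls[OF x, of "\<lambda>y. cls (?h y)"] by (simp add: tensor_algebra_def)
qed

lemma pure_closed [intro, simp]: "a \<in> carrier A \<Longrightarrow> s \<in> carrier S \<Longrightarrow> pt a s \<in> carrier T"
  by (simp add: pure_tensor_def cls_closed)

lemma pure_add_left:
  assumes "a \<in> carrier A" "b \<in> carrier A" "s \<in> carrier S"
  shows "pt (a \<oplus>\<^bsub>A\<^esub> b) s = pt a s \<oplus>\<^bsub>T\<^esub> pt b s"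
proof -
  have "frag_of (a, s) + frag_of (b, s) \<in> carrier G"
    using G.m_closed[of "frag_of (a, s)" "frag_of (b, s)"] assms by simp
  then show ?thesis
    using null_relations(1)[OF assms] assms unfolding pure_tensor_def
    by (subst cls_add; (subst cls_eq_iff)?) (auto simp: algebra_simps)
qed

lemma pure_add_right:
  assumes "a \<in> carrier A" "s \<in> carrier S" "t \<in> carrier S"
  shows "pt a (s \<oplus>\<^bsub>S\<^esub> t) = pt a s \<oplus>\<^bsub>T\<^esub> pt a t"
proof -
  have "frag_of (a, s) + frag_of (a, t) \<in> carrier G"
    using G.m_closed[of "frag_of (a, s)" "frag_of (a, t)"] assms by simp
  then show ?thesis
    using null_relations(2)[OF assms] assms unfolding pure_tensor_def
    by (subst cls_add; (subst cls_eq_iff)?) (auto simp: algebra_simps)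
qed

lemma pure_balanced:
  assumes "r \<in> carrier R" "a \<in> carrier A" "s \<in> carrier S"
  shows "pt (r \<odot>\<^bsub>A\<^esub> a) s = pt a (r \<odot>\<^bsub>S\<^esub> s)"
  using null_relations(3)[OF assms] assms unfolding pure_tensor_def
  by (subst cls_eq_iff) auto

lemma pure_mult:
  assumes "a \<in> carrier A" "b \<in> carrier A" "s \<in> carrier S" "t \<in> carrier S"
  shows "pt a s \<otimes>\<^bsub>T\<^esub> pt b t = pt (a \<otimes>\<^bsub>A\<^esub> b) (s \<otimes>\<^bsub>S\<^esub> t)"
  using assms unfolding pure_tensor_def by (subst cls_mult) (auto simp: formal_mult_of)

lemma pure_smult:
  assumes "a \<in> carrier A" "s \<in> carrier S" "t \<in> carrier S"
  shows "t \<odot>\<^bsub>T\<^esub> pt a s = pt a (t \<otimes>\<^bsub>S\<^esub> s)"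
  using assms unfolding pure_tensor_def by (subst cls_smult) auto

lemma carrier_add: "x \<in> carrier G \<Longrightarrow> y \<in> carrier G \<Longrightarrow> x + y \<in> carrier G"
  using G.m_closed[of x y] by simp

lemma carrier_diff: "x \<in> carrier G \<Longrightarrow> y \<in> carrier G \<Longrightarrow> x - y \<in> carrier G"
  using keys_diff[of x y] by auto

sublocale T: abelian_group T
proof (rule abelian_groupI)
  have zero: "0 \<in> carrier G" by simp
  show "\<zero>\<^bsub>T\<^esub> \<in> carrier T"
    unfolding zero_eq_cls by (rule cls_closed[OF zero])
  fix x assume "x \<in> carrier T"
  then obtain x' where x: "x' \<in> carrier G" "x = cls x'" by (rule cls_cases)
  show "\<zero>\<^bsub>T\<^esub> \<oplus>\<^bsub>T\<^esub> x = x"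
    unfolding x zero_eq_cls cls_add[OF zero x(1)] by simp
  have "0 - x' \<in> carrier G" using carrier_diff[OF zero x(1)] .
  then show "\<exists>y\<in>carrier T. y \<oplus>\<^bsub>T\<^esub> x = \<zero>\<^bsub>T\<^esub>"
    using cls_add[OF _ x(1)] cls_closed by (metis x(2) zero_eq_cls diff_add_cancel)
  fix y assume "y \<in> carrier T"
  then obtain y' where y: "y' \<in> carrier G" "y = cls y'" by (rule cls_cases)
  show "x \<oplus>\<^bsub>T\<^esub> y \<in> carrier T" "x \<oplus>\<^bsub>T\<^esub> y = y \<oplus>\<^bsub>T\<^esub> x"
    using x y carrier_add by (simp_all only: cls_add cls_closed add.commute)
  fix z assume "z \<in> carrier T"
  then obtain z' where z: "z' \<in> carrier G" "z = cls z'" by (rule cls_cases)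
  show "x \<oplus>\<^bsub>T\<^esub> y \<oplus>\<^bsub>T\<^esub> z = x \<oplus>\<^bsub>T\<^esub> (y \<oplus>\<^bsub>T\<^esub> z)"
    using x y z carrier_add by (simp only: cls_add add.assoc)
qed

lemma cls_diff:
  assumes "x \<in> carrier G" "y \<in> carrier G"
  shows "cls (x - y) = cls x \<ominus>\<^bsub>T\<^esub> cls y"
proof -
  have c: "x - y \<in> carrier G"
    using assms keys_diff[of x y] by auto
  have "cls x = cls (x - y) \<oplus>\<^bsub>T\<^esub> cls y"
    by (subst cls_add[OF c assms(2)]) simp
  then show ?thesis
    using c assms cls_closed by (simp add: T.minus_eq T.a_assoc T.r_neg)
qed

lemma pure_zero [simp]:
  "s \<in> carrier S \<Longrightarrow> pt \<zero>\<^bsub>A\<^esub> s = \<zero>\<^bsub>T\<^esub>" "a \<in> carrier A \<Longrightarrow> pt a \<zero>\<^bsub>S\<^esub> = \<zero>\<^bsub>T\<^esub>"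
  using pure_add_left[of "\<zero>\<^bsub>A\<^esub>" "\<zero>\<^bsub>A\<^esub>" s] pure_add_right[of a "\<zero>\<^bsub>S\<^esub>" "\<zero>\<^bsub>S\<^esub>"] by simp_all

text \<open>Negatives get no case of their own because -(a \<otimes> s) = (-a) \<otimes> s is again
  pure.\<close>

lemma tensor_induct [consumes 1, case_names pure add]:
  assumes "z \<in> carrier T"
    and pure: "\<And>a s. a \<in> carrier A \<Longrightarrow> s \<in> carrier S \<Longrightarrow> Q (pt a s)"
    and add: "\<And>x y. x \<in> carrier T \<Longrightarrow> y \<in> carrier T \<Longrightarrow> Q x \<Longrightarrow> Q y \<Longrightarrow> Q (x \<oplus>\<^bsub>T\<^esub> y)"
  shows "Q z"
proof -
  obtain x where x: "x \<in> carrier G" "z = cls x"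
    using assms(1) by (rule cls_cases)
  have Q0: "Q \<zero>\<^bsub>T\<^esub>" using pure[of "\<zero>\<^bsub>A\<^esub>" "\<zero>\<^bsub>S\<^esub>"] by simp
  have "Poly_Mapping.keys x \<subseteq> carrier A \<times> carrier S" using x by simp
  \<comment> \<open>Induction over formal sums has a case for differences, so the claim is proved
    for a class and its negative together.\<close>
  then have "Q (cls x) \<and> Q (\<ominus>\<^bsub>T\<^esub> cls x)"
  proof (induction x rule: free_Abelian_group_induct[consumes 1, case_names zero diff of])
    case zero
    have "\<ominus>\<^bsub>T\<^esub> \<zero>\<^bsub>T\<^esub> = \<zero>\<^bsub>T\<^esub>"
      by (metis T.r_zero T.l_neg T.zero_closed T.a_inv_closed)
    then show ?case using Q0 by (simp only: zero_eq_cls[symmetric] simp_thms)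
  next
    case (diff x y)
    then have c: "cls x \<in> carrier T" "cls y \<in> carrier T" "cls (x - y) = cls x \<ominus>\<^bsub>T\<^esub> cls y"
      by (simp_all add: cls_closed cls_diff)
    then have "\<ominus>\<^bsub>T\<^esub> cls (x - y) = \<ominus>\<^bsub>T\<^esub> cls x \<oplus>\<^bsub>T\<^esub> cls y"
      by (simp add: T.minus_eq T.minus_add)
    with c diff show ?case by (simp add: T.minus_eq add)
  next
    case (of p)
    then obtain a s where p: "p = (a, s)" "a \<in> carrier A" "s \<in> carrier S" by auto
    have "pt a s \<oplus>\<^bsub>T\<^esub> pt (\<ominus>\<^bsub>A\<^esub> a) s = \<zero>\<^bsub>T\<^esub>"
      using pure_add_left[of a "\<ominus>\<^bsub>A\<^esub> a" s] p by (simp add: A.r_neg)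
    then have "\<ominus>\<^bsub>T\<^esub> pt a s = pt (\<ominus>\<^bsub>A\<^esub> a) s"
      using p by (metis T.minus_equality T.a_comm pure_closed A.a_inv_closed)
    then show ?case
      using pure[of a s] pure[of "\<ominus>\<^bsub>A\<^esub> a" s] p by (simp add: pure_tensor_def)
  qed
  then show ?thesis using x by blast
qed

lemma tensor_mult_closed: "x \<in> carrier T \<Longrightarrow> y \<in> carrier T \<Longrightarrow> x \<otimes>\<^bsub>T\<^esub> y \<in> carrier T"
  by (metis cls_cases cls_mult cls_closed formal_mult_closed)

lemma tensor_l_distr:
  assumes "x \<in> carrier T" "y \<in> carrier T" "z \<in> carrier T"
  shows "(x \<oplus>\<^bsub>T\<^esub> y) \<otimes>\<^bsub>T\<^esub> z = x \<otimes>\<^bsub>T\<^esub> z \<oplus>\<^bsub>T\<^esub> y \<otimes>\<^bsub>T\<^esub> z"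
proof -
  obtain x' y' z' where *: "x' \<in> carrier G" "y' \<in> carrier G" "z' \<in> carrier G"
    "x = cls x'" "y = cls y'" "z = cls z'" using assms by (metis cls_cases)
  then show ?thesis
    by (simp only: cls_add cls_mult carrier_add formal_mult_closed formal_mult_add_left)
qed

lemma tensor_r_distr:
  assumes "x \<in> carrier T" "y \<in> carrier T" "z \<in> carrier T"
  shows "z \<otimes>\<^bsub>T\<^esub> (x \<oplus>\<^bsub>T\<^esub> y) = z \<otimes>\<^bsub>T\<^esub> x \<oplus>\<^bsub>T\<^esub> z \<otimes>\<^bsub>T\<^esub> y"
proof -
  obtain x' y' z' where *: "x' \<in> carrier G" "y' \<in> carrier G" "z' \<in> carrier G"
    "x = cls x'" "y = cls y'" "z = cls z'" using assms by (metis cls_cases)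
  then show ?thesis
    by (simp only: cls_add cls_mult carrier_add formal_mult_closed formal_mult_add_right)
qed

lemma tensor_smult_closed: 
  assumes "t \<in> carrier S" "x \<in> carrier T"
  shows "t \<odot>\<^bsub>T\<^esub> x \<in> carrier T"
proof -
  obtain x' where *: "x' \<in> carrier G" "x = cls x'" using assms by (metis cls_cases)
  show ?thesis unfolding * using assms(1) *(1)
    by (subst cls_smult) (auto intro!: cls_closed frag_extend_closed simp del: carrier_free_Abelian_group_iff)
qed

lemma tensor_smult_r_distr:
  assumes "t \<in> carrier S" "x \<in> carrier T" "y \<in> carrier T"
  shows "t \<odot>\<^bsub>T\<^esub> (x \<oplus>\<^bsub>T\<^esub> y) = t \<odot>\<^bsub>T\<^esub> x \<oplus>\<^bsub>T\<^esub> t \<odot>\<^bsub>T\<^esub> y"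
proof -
  obtain x' y' where *: "x' \<in> carrier G" "y' \<in> carrier G" "x = cls x'" "y = cls y'"
    using assms by (metis cls_cases)
  have c: "frag_extend (\<lambda>(a, s). frag_of (a, t \<otimes>\<^bsub>S\<^esub> s)) x \<in> carrier G" if "x \<in> carrier G" for x
    using that assms(1) by (intro frag_extend_closed) auto
  show ?thesis using assms(1) *(1,2) c unfolding *
    by (simp only: cls_add cls_smult carrier_add frag_extend_add)
qed

lemma one_eq_pure: "\<one>\<^bsub>T\<^esub> = pt \<one>\<^bsub>A\<^esub> \<one>\<^bsub>S\<^esub>"
  by (simp add: tensor_algebra_def)

text \<open>Both sides are additive in each factor, so one factor at a time can be reduced to pure
  tensors.\<close>

lemma tensor_smult_mult:
  assumes "t \<in> carrier S" "x \<in> carrier T" "y \<in> carrier T"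
  shows "(t \<odot>\<^bsub>T\<^esub> x) \<otimes>\<^bsub>T\<^esub> y = t \<odot>\<^bsub>T\<^esub> (x \<otimes>\<^bsub>T\<^esub> y)"
    and "x \<otimes>\<^bsub>T\<^esub> (t \<odot>\<^bsub>T\<^esub> y) = t \<odot>\<^bsub>T\<^esub> (x \<otimes>\<^bsub>T\<^esub> y)"
proof -
  note simps = assms(1) pure_mult pure_smult tensor_smult_closed tensor_mult_closed
    tensor_l_distr tensor_r_distr tensor_smult_r_distr
  have 1: "(t \<odot>\<^bsub>T\<^esub> pt a s) \<otimes>\<^bsub>T\<^esub> y = t \<odot>\<^bsub>T\<^esub> (pt a s \<otimes>\<^bsub>T\<^esub> y)"
    and 2: "pt a s \<otimes>\<^bsub>T\<^esub> (t \<odot>\<^bsub>T\<^esub> y) = t \<odot>\<^bsub>T\<^esub> (pt a s \<otimes>\<^bsub>T\<^esub> y)"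
    if "a \<in> carrier A" "s \<in> carrier S" for a s
    using assms(3)
    by (induction rule: tensor_induct) (simp_all add: that simps S.m_assoc S.m_lcomm)
  show "(t \<odot>\<^bsub>T\<^esub> x) \<otimes>\<^bsub>T\<^esub> y = t \<odot>\<^bsub>T\<^esub> (x \<otimes>\<^bsub>T\<^esub> y)"
    using assms(2) by (induction rule: tensor_induct) (simp_all only: 1, simp add: assms simps)
  show "x \<otimes>\<^bsub>T\<^esub> (t \<odot>\<^bsub>T\<^esub> y) = t \<odot>\<^bsub>T\<^esub> (x \<otimes>\<^bsub>T\<^esub> y)"
    using assms(2) by (induction rule: tensor_induct) (simp_all only: 2, simp add: assms simps)
qed

lemma tensor_mult_assoc:
  assumes "x \<in> carrier T" "y \<in> carrier T" "z \<in> carrier T"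
  shows "x \<otimes>\<^bsub>T\<^esub> y \<otimes>\<^bsub>T\<^esub> z = x \<otimes>\<^bsub>T\<^esub> (y \<otimes>\<^bsub>T\<^esub> z)"
proof -
  have 1: "pt a s \<otimes>\<^bsub>T\<^esub> pt b t \<otimes>\<^bsub>T\<^esub> z = pt a s \<otimes>\<^bsub>T\<^esub> (pt b t \<otimes>\<^bsub>T\<^esub> z)"
    if "a \<in> carrier A" "s \<in> carrier S" "b \<in> carrier A" "t \<in> carrier S" for a s b t
    using assms(3)
    by (induction rule: tensor_induct) (simp_all add: that pure_mult S.m_assoc A.m_assoc tensor_mult_closed tensor_r_distr)
  have 2: "pt a s \<otimes>\<^bsub>T\<^esub> y \<otimes>\<^bsub>T\<^esub> z = pt a s \<otimes>\<^bsub>T\<^esub> (y \<otimes>\<^bsub>T\<^esub> z)"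
    if "a \<in> carrier A" "s \<in> carrier S" for a s
    using assms(2)
    by (induction rule: tensor_induct)
      (simp_all add: that 1 assms(3) tensor_mult_closed tensor_l_distr tensor_r_distr)
  show ?thesis
    using assms(1)
    by (induction rule: tensor_induct)
      (simp_all add: 2 assms tensor_mult_closed tensor_l_distr)
qed

lemma ring_tensor: "Ring.ring T"
proof (rule ringI)
  show "abelian_group T" ..
  have one: "\<one>\<^bsub>T\<^esub> \<in> carrier T" by (simp add: one_eq_pure)
  have "\<one>\<^bsub>T\<^esub> \<otimes>\<^bsub>T\<^esub> x = x" "x \<otimes>\<^bsub>T\<^esub> \<one>\<^bsub>T\<^esub> = x" if "x \<in> carrier T" for x
    using that
    by (induction rule: tensor_induct)
      (simp_all add: one_eq_pure pure_mult tensor_l_distr tensor_r_distr)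
  then show "Group.monoid T"
    using one by (intro monoidI) (auto simp: tensor_mult_closed tensor_mult_assoc)
qed (auto simp: tensor_l_distr tensor_r_distr)

lemma module_tensor: "Module.module S T"
proof (rule Module.moduleI)
  show "cring S" ..
  show "abelian_group T" ..
  fix t u x assume tu: "t \<in> carrier S" "u \<in> carrier S" and x: "x \<in> carrier T"
  show "(t \<oplus>\<^bsub>S\<^esub> u) \<odot>\<^bsub>T\<^esub> x = t \<odot>\<^bsub>T\<^esub> x \<oplus>\<^bsub>T\<^esub> u \<odot>\<^bsub>T\<^esub> x"
    using x
  proof (induction rule: tensor_induct)
    case (add x y)
    then show ?case
      using tu T.add.m_ac by (simp add: tensor_smult_r_distr tensor_smult_closed)
  qed (simp add: tu pure_smult S.l_distr pure_add_right)
  show "(t \<otimes>\<^bsub>S\<^esub> u) \<odot>\<^bsub>T\<^esub> x = t \<odot>\<^bsub>T\<^esub> (u \<odot>\<^bsub>T\<^esub> x)"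
    using x by (induction rule: tensor_induct)
     (simp_all add: tu pure_smult S.m_assoc tensor_smult_r_distr tensor_smult_closed)
next
  fix x assume "x \<in> carrier T"
  then show "\<one>\<^bsub>S\<^esub> \<odot>\<^bsub>T\<^esub> x = x"
    by (induction rule: tensor_induct) (simp_all add: pure_smult tensor_smult_r_distr)
qed (auto simp: tensor_smult_closed tensor_smult_r_distr)

lemma assoc_algebra_tensor: "assoc_algebra S T"
  by (simp add: assoc_algebra_def module_tensor ring_tensor tensor_smult_mult)

text \<open>The target is only an abelian group and the map only additive. That is enough to produce
  coordinate functionals, which will show that the basis column is independent.\<close>

lemma tensor_universal:
  assumes "abelian_group M"
    and closed: "\<And>a s. a \<in> carrier A \<Longrightarrow> s \<in> carrier S \<Longrightarrow> b a s \<in> carrier M"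
    and addl: "\<And>a a' s. a \<in> carrier A \<Longrightarrow> a' \<in> carrier A \<Longrightarrow> s \<in> carrier S \<Longrightarrow>
      b (a \<oplus>\<^bsub>A\<^esub> a') s = b a s \<oplus>\<^bsub>M\<^esub> b a' s"
    and addr: "\<And>a s s'. a \<in> carrier A \<Longrightarrow> s \<in> carrier S \<Longrightarrow> s' \<in> carrier S \<Longrightarrow>
      b a (s \<oplus>\<^bsub>S\<^esub> s') = b a s \<oplus>\<^bsub>M\<^esub> b a s'"
    and bal: "\<And>r a s. r \<in> carrier R \<Longrightarrow> a \<in> carrier A \<Longrightarrow> s \<in> carrier S \<Longrightarrow>
      b (r \<odot>\<^bsub>A\<^esub> a) s = b a (r \<odot>\<^bsub>S\<^esub> s)"
  obtains g where "g \<in> carrier T \<rightarrow> carrier M"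
    "\<And>x y. x \<in> carrier T \<Longrightarrow> y \<in> carrier T \<Longrightarrow> g (x \<oplus>\<^bsub>T\<^esub> y) = g x \<oplus>\<^bsub>M\<^esub> g y"
    "\<And>a s. a \<in> carrier A \<Longrightarrow> s \<in> carrier S \<Longrightarrow> g (pt a s) = b a s"
proof -
  interpret M: abelian_group M by fact
  have "case_prod b ` (carrier A \<times> carrier S) \<subseteq> carrier (add_monoid M)"
    using closed by auto
  then obtain h where h: "h \<in> hom G (add_monoid M)"
    and hb: "\<And>p. p \<in> carrier A \<times> carrier S \<Longrightarrow> h (frag_of p) = case_prod b p"
    using comm_group.free_Abelian_group_universal[OF M.a_comm_group] by blast
  have hc: "h x \<in> carrier M" if "x \<in> carrier G" for x
    using hom_in_carrier[OF h that] by simp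
  have ha: "h (x + y) = h x \<oplus>\<^bsub>M\<^esub> h y" if "x \<in> carrier G" "y \<in> carrier G" for x y
    using hom_mult[OF h that] by simp
  have hd: "h (x - y) = h x \<ominus>\<^bsub>M\<^esub> h y" if xy: "x \<in> carrier G" "y \<in> carrier G" for x y
  proof -
    have "x - y \<in> carrier G" using xy keys_diff[of x y] by auto
    moreover from this have "h x = h (x - y) \<oplus>\<^bsub>M\<^esub> h y" using ha[of "x - y" y] xy by simp
    ultimately show ?thesis using xy hc by (simp add: M.minus_eq M.a_assoc M.r_neg)
  qed
  have cancel: "u \<oplus>\<^bsub>M\<^esub> v \<ominus>\<^bsub>M\<^esub> u \<ominus>\<^bsub>M\<^esub> v = \<zero>\<^bsub>M\<^esub>"
    if "u \<in> carrier M" "v \<in> carrier M" for u v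
    using that by (simp add: M.minus_eq M.a_comm[of u v] M.a_assoc M.r_neg)
  have ker: "h x = \<zero>\<^bsub>M\<^esub>" if "x \<in> N" for x
    using that
  proof (induction rule: null_induct)
    case (add_left a a' s)
    then show ?case
      using carrier_diff[of "frag_of (a \<oplus>\<^bsub>A\<^esub> a', s)" "frag_of (a, s)"]
      by (simp add: hd hb addl closed cancel)
  next
    case (add_right a s t)
    then show ?case
      using carrier_diff[of "frag_of (a, s \<oplus>\<^bsub>S\<^esub> t)" "frag_of (a, s)"]
      by (simp add: hd hb addr closed cancel)
  next
    case (balanced r a s)
    then show ?case by (simp add: hd hb bal closed M.minus_eq M.r_neg)
  next
    case (diff x y)
    then show ?case using null_subset by (simp add: hd M.minus_eq)
  qed
  have heq: "h x = h y" if "x \<in> carrier G" "y \<in> carrier G" "x - y \<in> N" for x y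
    using ha[of "x - y" y] ker[OF that(3)] carrier_diff[OF that(1,2)] hc that by simp
  \<comment> \<open>By \<open>heq\<close> the choice of the representative does not affect the
    value.\<close>
  define g where "g z = h (SOME x. x \<in> carrier G \<and> z = cls x)" for z
  have g_cls: "g (cls x) = h x" if "x \<in> carrier G" for x
  proof -
    define y where "y = (SOME y. y \<in> carrier G \<and> cls x = cls y)"
    have "y \<in> carrier G \<and> cls x = cls y"
      unfolding y_def by (rule someI[of _ x]) (use that in simp)
    then have "h y = h x"
      using that cls_eq_iff[of y x] heq by metis
    then show ?thesis by (simp add: g_def y_def)
  qed
  show thesis
  proof
    show "g \<in> carrier T \<rightarrow> carrier M"
      using g_cls hc by (metis Pi_I cls_cases)
    show "g (x \<oplus>\<^bsub>T\<^esub> y) = g x \<oplus>\<^bsub>M\<^esub> g y" if "x \<in> carrier T" "y \<in> carrier T" for x y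
      using that g_cls ha carrier_add by (metis cls_add cls_cases)
    show "g (pt a s) = b a s" if "a \<in> carrier A" "s \<in> carrier S" for a s
      using that g_cls[of "frag_of (a, s)"] hb[of "(a, s)"] by (simp add: pure_tensor_def)
  qed
qed

end

text \<open>Only linearity over \<open>R\<close> is asked of \<open>h\<close>, so that one
  construction serves both the Galois automorphisms and the derivation \<open>D\<close>, which is
  linear over the constants but not multiplicative.\<close>

locale tensor_hom = T1: tensor_product R A S + T2: tensor_product R A S'
  for R :: "('r, 'x) ring_scheme" and A :: "('r, 'a, 'y) module_scheme"
    and S :: "('r, 's, 'z) module_scheme" and S' :: "('r, 't, 'w) module_scheme" +
  fixes h :: "'s \<Rightarrow> 't"
  assumes hom: "h \<in> module_hom R S S'"
begin

abbreviation "th \<equiv> tensor_map R A S S' h"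

lemma h_closed: "s \<in> carrier S \<Longrightarrow> h s \<in> carrier S'"
  using module_hom_closed[OF hom] by blast

lemma tensor_map_cls:
  assumes x: "x \<in> carrier T1.G"
  shows "th (T1.cls x) = T2.cls (frag_extend (\<lambda>(a, s). frag_of (a, h s)) x)"
    and "frag_extend (\<lambda>(a, s). frag_of (a, h s)) x \<in> carrier T2.G"
proof -
  let ?h = "frag_extend (\<lambda>(a, s). frag_of (a, h s))"
  have closed: "?h y \<in> carrier T2.G" if "y \<in> carrier T1.G" for y
    using that h_closed by (intro T1.frag_extend_closed) auto
  show "?h x \<in> carrier T2.G" using closed x .
  have null: "?h y \<in> T2.N" if "y \<in> T1.N" for y
    using that
    by (induction rule: T1.null_induct)
      (simp_all add: frag_extend_diff T2.null_diff T2.null_relations h_closed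
        module_hom_add[OF hom] module_hom_smult[OF hom])
  have "T2.cls (?h y) = T2.cls (?h x)" if "y \<in> carrier T1.G" "y - x \<in> T1.N" for y
    using null[OF that(2)] closed that(1) x by (simp only: T2.cls_eq_iff frag_extend_diff)
  then show "th (T1.cls x) = T2.cls (?h x)"
    using T1.UN_cls[OF x, of "\<lambda>y. T2.cls (?h y)"] by (simp add: tensor_map_def)
qed

lemma tensor_map_closed: "z \<in> carrier T1.T \<Longrightarrow> th z \<in> carrier T2.T"
  by (metis T1.cls_cases tensor_map_cls T2.cls_closed)

lemma tensor_map_add:
  assumes "x \<in> carrier T1.T" "y \<in> carrier T1.T"
  shows "th (x \<oplus>\<^bsub>T1.T\<^esub> y) = th x \<oplus>\<^bsub>T2.T\<^esub> th y"
proof -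
  obtain x' y' where *: "x' \<in> carrier T1.G" "y' \<in> carrier T1.G" "x = T1.cls x'" "y = T1.cls y'"
    using assms by (metis T1.cls_cases)
  then show ?thesis
    by (simp only: T1.cls_add T2.cls_add T1.carrier_add tensor_map_cls frag_extend_add)
qed

lemma tensor_map_pure:
  assumes "a \<in> carrier A" "s \<in> carrier S"
  shows "th (T1.pt a s) = T2.pt a (h s)"
  using assms unfolding pure_tensor_def by (subst tensor_map_cls) auto

end

section \<open>Bases and linear combinations\<close>

text \<open>The map need only be additive on a submonoid \<open>H\<close>. Taken with the identity
  map, the statement gives closure of \<open>H\<close> under finite sums and compares sums formed in
  two records. The value at zero is a separate assumption because monoids have no
  cancellation.\<close>

lemma finsum_additive:
  assumes "abelian_monoid M" "abelian_monoid M'" "H \<subseteq> carrier M" "\<zero>\<^bsub>M\<^esub> \<in> H"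
    and "\<And>x y. x \<in> H \<Longrightarrow> y \<in> H \<Longrightarrow> x \<oplus>\<^bsub>M\<^esub> y \<in> H"
    and "\<phi> \<in> H \<rightarrow> carrier M'" "\<phi> \<zero>\<^bsub>M\<^esub> = \<zero>\<^bsub>M'\<^esub>"
    and "\<And>x y. x \<in> H \<Longrightarrow> y \<in> H \<Longrightarrow> \<phi> (x \<oplus>\<^bsub>M\<^esub> y) = \<phi> x \<oplus>\<^bsub>M'\<^esub> \<phi> y"
    and "finite I" "u \<in> I \<rightarrow> H"
  shows "finsum M u I \<in> H" "\<phi> (finsum M u I) = (\<Oplus>\<^bsub>M'\<^esub>i\<in>I. \<phi> (u i))"
proof -
  interpret M: abelian_monoid M by fact
  interpret M': abelian_monoid M' by fact
  have "finsum M u I \<in> H \<and> \<phi> (finsum M u I) = (\<Oplus>\<^bsub>M'\<^esub>i\<in>I. \<phi> (u i))"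
    using assms(9,10)
  proof (induction I rule: finite_induct)
    case (insert i I)
    then have "u i \<in> H" "u \<in> I \<rightarrow> carrier M" "u i \<in> carrier M"
      "(\<lambda>i. \<phi> (u i)) \<in> I \<rightarrow> carrier M'" "\<phi> (u i) \<in> carrier M'"
      using assms(3,6) by (auto simp: Pi_iff)
    then show ?case
      using insert assms(5,8) by (simp add: M.finsum_insert M'.finsum_insert)
  qed (use assms in simp)
  then show "finsum M u I \<in> H" "\<phi> (finsum M u I) = (\<Oplus>\<^bsub>M'\<^esub>i\<in>I. \<phi> (u i))" by blast+
qed

text \<open>Coefficients are indexed by position and not, as in \<open>lincomb\<close>, by basis
  vector, so that a row of a matrix can serve as coefficients.\<close>

definition lin_comb ::
  "('r, 'b, 'y) module_scheme \<Rightarrow> nat \<Rightarrow> (nat \<Rightarrow> 'r) \<Rightarrow> (nat \<Rightarrow> 'b) \<Rightarrow> 'b" where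
  "lin_comb B n x v = (\<Oplus>\<^bsub>B\<^esub>i\<in>{..<n}. x i \<odot>\<^bsub>B\<^esub> v i)"

context Module.module
begin

lemma lin_comb_closed:
  "v \<in> {..<n} \<rightarrow> carrier M \<Longrightarrow> x \<in> {..<n} \<rightarrow> carrier R \<Longrightarrow> lin_comb M n x v \<in> carrier M"
  unfolding lin_comb_def by (intro M.finsum_closed) auto

lemma lin_comb_cong:
  assumes "v \<in> {..<n} \<rightarrow> carrier M" "y \<in> {..<n} \<rightarrow> carrier R"
    and "\<And>i. i < n \<Longrightarrow> x i = y i" "\<And>i. i < n \<Longrightarrow> w i = v i"
  shows "lin_comb M n x w = lin_comb M n y v"
  unfolding lin_comb_def using assms by (intro M.finsum_cong') (auto simp: Pi_iff)

lemma lin_comb_add: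
  assumes "v \<in> {..<n} \<rightarrow> carrier M" "x \<in> {..<n} \<rightarrow> carrier R" "y \<in> {..<n} \<rightarrow> carrier R"
  shows "lin_comb M n (\<lambda>i. x i \<oplus> y i) v = lin_comb M n x v \<oplus>\<^bsub>M\<^esub> lin_comb M n y v"
proof -
  have "lin_comb M n (\<lambda>i. x i \<oplus> y i) v = (\<Oplus>\<^bsub>M\<^esub>i\<in>{..<n}. x i \<odot>\<^bsub>M\<^esub> v i \<oplus>\<^bsub>M\<^esub> y i \<odot>\<^bsub>M\<^esub> v i)"
    unfolding lin_comb_def using assms by (intro M.finsum_cong') (auto simp: smult_l_distr Pi_iff)
  also have "\<dots> = lin_comb M n x v \<oplus>\<^bsub>M\<^esub> lin_comb M n y v"
    unfolding lin_comb_def using assms by (intro M.finsum_addf) (auto simp: Pi_iff)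
  finally show ?thesis .
qed

lemma smult_lin_comb:
  assumes "v \<in> {..<n} \<rightarrow> carrier M" "x \<in> {..<n} \<rightarrow> carrier R" "y \<in> carrier R"
  shows "y \<odot>\<^bsub>M\<^esub> lin_comb M n x v = lin_comb M n (\<lambda>i. y \<otimes> x i) v"
proof -
  have "y \<odot>\<^bsub>M\<^esub> lin_comb M n x v = (\<Oplus>\<^bsub>M\<^esub>i\<in>{..<n}. y \<odot>\<^bsub>M\<^esub> (x i \<odot>\<^bsub>M\<^esub> v i))"
    unfolding lin_comb_def
    by (rule finsum_additive(2)[of M M "carrier M" "\<lambda>z. y \<odot>\<^bsub>M\<^esub> z"])
      (use assms in \<open>auto simp: smult_r_distr Pi_iff intro: M.abelian_monoid_axioms\<close>)
  also have "\<dots> = lin_comb M n (\<lambda>i. y \<otimes> x i) v"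
    unfolding lin_comb_def using assms
    by (intro M.finsum_cong') (auto simp: smult_assoc1 Pi_iff)
  finally show ?thesis .
qed

lemma lin_comb_unit:
  assumes "v \<in> {..<n} \<rightarrow> carrier M" "i < n"
  shows "lin_comb M n (\<lambda>j. if i = j then \<one> else \<zero>) v = v i"
proof -
  have "lin_comb M n (\<lambda>j. if i = j then \<one> else \<zero>) v = (\<Oplus>\<^bsub>M\<^esub>j\<in>{..<n}. if i = j then v j else \<zero>\<^bsub>M\<^esub>)"
    unfolding lin_comb_def using assms by (intro M.finsum_cong') (auto simp: Pi_iff)
  also have "\<dots> = v i"
    using assms by (intro M.add.finprod_singleton) auto
  finally show ?thesis .
qed

end

lemma mat_column_eq_lin_comb: "mat_column B n M v i = lin_comb B n (\<lambda>j. M $$ (i, j)) v"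
  by (simp add: mat_column_def lin_comb_def)

text \<open>An ordered basis, expressed by existence and uniqueness of coordinates. Coefficients are
  functions on all of \<open>nat\<close>, so uniqueness concerns indices below \<open>n\<close>
  only. The notion is applied to \<open>A\<close> over \<open>C\<close>, to the form over
  \<open>F\<close>, and to the scalar extension over the whole field.\<close>

definition frame ::
  "('r, 'x) ring_scheme \<Rightarrow> ('r, 'b, 'y) module_scheme \<Rightarrow> nat \<Rightarrow> (nat \<Rightarrow> 'b) \<Rightarrow> bool" where
  "frame R B n v \<longleftrightarrow> v \<in> {..<n} \<rightarrow> carrier B \<and>
     (\<forall>z\<in>carrier B. \<exists>x\<in>{..<n} \<rightarrow> carrier R. z = lin_comb B n x v) \<and>
     (\<forall>x\<in>{..<n} \<rightarrow> carrier R. \<forall>y\<in>{..<n} \<rightarrow> carrier R.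
        lin_comb B n x v = lin_comb B n y v \<longrightarrow> (\<forall>i<n. x i = y i))"

lemma (in vectorspace) indexed_basis_imp_frame:
  assumes "indexed_basis K V n b"
  shows "frame K V n b"
proof -
  let ?A = "b ` {..<n}"
  have inj: "inj_on b {..<n}" and "basis ?A"
    using assms by (simp_all add: indexed_basis_def)
  then have sub: "?A \<subseteq> carrier V" by (simp add: basis_def)
  have ex1: "\<exists>!a. a \<in> ?A \<rightarrow>\<^sub>E carrier K \<and> lincomb a ?A = z" if "z \<in> carrier V" for z
    using basis_criterion[of ?A] \<open>basis ?A\<close> sub that by auto
  have lincomb: "lincomb a ?A = lin_comb V n (\<lambda>i. a (b i)) b" if "a \<in> ?A \<rightarrow> carrier K" for a
    unfolding lincomb_def lin_comb_def
    by (rule finsum_reindex) (use inj sub that in auto)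
  have "\<exists>x\<in>{..<n} \<rightarrow> carrier K. z = lin_comb V n x b" if z: "z \<in> carrier V" for z
  proof -
    obtain a where a: "a \<in> ?A \<rightarrow>\<^sub>E carrier K" "lincomb a ?A = z"
      using ex1[OF z] by blast
    then have "a \<in> ?A \<rightarrow> carrier K" by (simp add: PiE_def)
    then show ?thesis
      using a(2) lincomb by (intro bexI[of _ "\<lambda>i. a (b i)"]) auto
  qed
  moreover have "x i = y i"
    if xy: "x \<in> {..<n} \<rightarrow> carrier K" "y \<in> {..<n} \<rightarrow> carrier K"
      "lin_comb V n x b = lin_comb V n y b" "i < n" for x y i
  proof -
    \<comment> \<open>\<open>basis_criterion\<close> gives uniqueness among extensional functions on
      the set of basis vectors; a coefficient sequence is moved there along the inverse of
      \<open>b\<close>.\<close>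
    define c where "c x = restrict (x \<circ> inv_into {..<n} b) ?A" for x :: "nat \<Rightarrow> 'a"
    have c: "c x (b i) = x i" if "i < n" for x i
      using that inj by (simp add: c_def inv_into_f_f)
    have mem: "c x \<in> ?A \<rightarrow>\<^sub>E carrier K" if "x \<in> {..<n} \<rightarrow> carrier K" for x
      using that c[of _ x] by (auto simp: c_def)
    have closed: "lin_comb V n x b \<in> carrier V" if "x \<in> {..<n} \<rightarrow> carrier K" for x
      unfolding lin_comb_def using that sub by (intro finsum_closed) auto
    have eq: "lincomb (c x) ?A = lin_comb V n x b" if "x \<in> {..<n} \<rightarrow> carrier K" for x
    proof -
      have "lincomb (c x) ?A = lin_comb V n (\<lambda>i. c x (b i)) b"
        using mem[OF that] by (intro lincomb) (simp add: PiE_def)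
      also have "\<dots> = lin_comb V n x b"
        unfolding lin_comb_def using that sub c[of _ x] by (intro finsum_cong') auto
      finally show ?thesis .
    qed
    have "c x = c y"
      using ex1[OF closed[OF xy(1)]] mem[OF xy(1)] mem[OF xy(2)] eq[OF xy(1)] eq[OF xy(2)] xy(3)
      by auto
    then show ?thesis using c[OF xy(4)] by metis
  qed
  ultimately show ?thesis
    using sub unfolding frame_def by blast
qed

section \<open>Matrices and semilinear derivations over the large field\<close>

definition semilinear_derivation ::
  "('k \<Rightarrow> 'k) \<Rightarrow> ('k, 'b, 'y) module_scheme \<Rightarrow> ('b \<Rightarrow> 'b) \<Rightarrow> bool" where
  "semilinear_derivation D B \<delta> \<longleftrightarrow> derivation B \<delta> \<and>
     (\<forall>x. \<forall>z\<in>carrier B. \<delta> (x \<odot>\<^bsub>B\<^esub> z) = D x \<odot>\<^bsub>B\<^esub> z \<oplus>\<^bsub>B\<^esub> x \<odot>\<^bsub>B\<^esub> \<delta> z)"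

text \<open>The scalars fill a whole type, so the rules of \<open>Module.module\<close> can be
  restated without membership conditions on scalars.\<close>

locale algebra_over_field =
  fixes T :: "('k::field, 't, 'x) module_scheme" (structure)
  assumes assoc_algebra: "assoc_algebra class_ring T"
begin

sublocale Ring.ring T using assoc_algebra by (simp add: assoc_algebra_def)
sublocale M: Module.module class_ring T using assoc_algebra by (simp add: assoc_algebra_def)

lemma smult_simps [simp]:
  "v \<in> carrier T \<Longrightarrow> x \<odot> v \<in> carrier T"
  "v \<in> carrier T \<Longrightarrow> 1 \<odot> v = v"
  "v \<in> carrier T \<Longrightarrow> 0 \<odot> v = \<zero>"
  "x \<odot> \<zero> = \<zero>"
  using M.smult_closed[of x v] M.smult_one[of v] M.smult_l_null[of v] M.smult_r_null[of x] by simp_all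

lemma smult_add_left: "v \<in> carrier T \<Longrightarrow> (x + y) \<odot> v = x \<odot> v \<oplus> y \<odot> v"
  using M.smult_l_distr[of x y v] by simp

lemma smult_add_right: "v \<in> carrier T \<Longrightarrow> w \<in> carrier T \<Longrightarrow> x \<odot> (v \<oplus> w) = x \<odot> v \<oplus> x \<odot> w"
  using M.smult_r_distr[of x v w] by simp

lemma smult_smult: "v \<in> carrier T \<Longrightarrow> x \<odot> (y \<odot> v) = (x * y) \<odot> v"
  using M.smult_assoc1[of x y v] by simp

lemma smult_minus_right: "v \<in> carrier T \<Longrightarrow> x \<odot> (\<ominus> v) = \<ominus> (x \<odot> v)"
  using M.smult_r_minus[of x v] by simp

lemma smult_minus_left: "v \<in> carrier T \<Longrightarrow> (- x) \<odot> v = \<ominus> (x \<odot> v)"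
  by (rule minus_equality[symmetric]) (simp_all flip: smult_add_left)

lemma smult_mult:
  assumes "v \<in> carrier T" "w \<in> carrier T"
  shows "(x \<odot> v) \<otimes> w = x \<odot> (v \<otimes> w)" "v \<otimes> (x \<odot> w) = x \<odot> (v \<otimes> w)"
  using assoc_algebra assms by (simp_all add: assoc_algebra_def)

lemma lin_comb_closed [simp]: "v \<in> {..<n} \<rightarrow> carrier T \<Longrightarrow> lin_comb T n x v \<in> carrier T"
  by (rule M.lin_comb_closed) auto

lemma lin_comb_cong:
  assumes "v \<in> {..<n} \<rightarrow> carrier T" "\<And>i. i < n \<Longrightarrow> x i = y i" "\<And>i. i < n \<Longrightarrow> w i = v i"
  shows "lin_comb T n x w = lin_comb T n y v"
  using assms by (intro M.lin_comb_cong) auto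

lemma lin_comb_add:
  "v \<in> {..<n} \<rightarrow> carrier T \<Longrightarrow>
     lin_comb T n (\<lambda>i. x i + y i) v = lin_comb T n x v \<oplus> lin_comb T n y v"
  using M.lin_comb_add[of v n x y] by simp

lemma smult_lin_comb:
  "v \<in> {..<n} \<rightarrow> carrier T \<Longrightarrow> y \<odot> lin_comb T n x v = lin_comb T n (\<lambda>i. y * x i) v"
  using M.smult_lin_comb[of v n x y] by simp

lemma lin_comb_minus:
  assumes "v \<in> {..<n} \<rightarrow> carrier T"
  shows "lin_comb T n (\<lambda>i. x i - y i) v = lin_comb T n x v \<ominus> lin_comb T n y v"
  using lin_comb_add[OF assms, of x "\<lambda>i. - 1 * y i"] smult_lin_comb[OF assms, of "- 1" y]
  by (simp add: smult_minus_left minus_eq assms)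

lemma lin_comb_zero_left: "v \<in> {..<n} \<rightarrow> carrier T \<Longrightarrow> lin_comb T n (\<lambda>i. 0) v = \<zero>"
  unfolding lin_comb_def by (auto simp: Pi_iff intro!: add.finprod_one_eqI)

lemma lin_comb_zero_right:
  assumes "\<And>i. i < n \<Longrightarrow> v i = \<zero>"
  shows "lin_comb T n x v = \<zero>"
  unfolding lin_comb_def using assms by (intro add.finprod_one_eqI) simp

lemma lin_comb_unit:
  "v \<in> {..<n} \<rightarrow> carrier T \<Longrightarrow> i < n \<Longrightarrow> lin_comb T n (\<lambda>j. if i = j then 1 else 0) v = v i"
  using M.lin_comb_unit[of v n i] by (simp cong: if_cong)

lemma module_hom_lin_comb:
  assumes \<phi>: "\<phi> \<in> module_hom class_ring T T" and v: "v \<in> {..<n} \<rightarrow> carrier T"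
  shows "\<phi> (lin_comb T n x v) = lin_comb T n x (\<lambda>i. \<phi> (v i))"
proof -
  have closed: "\<phi> u \<in> carrier T" if "u \<in> carrier T" for u
    using module_hom_closed[OF \<phi>] that by auto
  have smult: "\<phi> (y \<odot> u) = y \<odot> \<phi> u" if "u \<in> carrier T" for y u
    using module_hom_smult[OF \<phi>, of y u] that by simp
  have "\<phi> \<zero> = \<zero>"
    using smult[of \<zero> 0] closed[of \<zero>] by simp
  then have "\<phi> (lin_comb T n x v) = (\<Oplus>i\<in>{..<n}. \<phi> (x i \<odot> v i))"
    unfolding lin_comb_def using v closed module_hom_add[OF \<phi>]
    by (intro finsum_additive(2)[of T T "carrier T"]) (auto simp: Pi_iff intro: abelian_monoid_axioms)
  also have "\<dots> = lin_comb T n x (\<lambda>i. \<phi> (v i))"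
    unfolding lin_comb_def using v closed smult by (intro finsum_cong') (auto simp: Pi_iff)
  finally show ?thesis .
qed

lemma finsum_lin_comb:
  assumes v: "v \<in> {..<n} \<rightarrow> carrier T" and "finite I"
  shows "(\<Oplus>i\<in>I. lin_comb T n (y i) v) = lin_comb T n (\<lambda>j. \<Sum>i\<in>I. y i j) v"
  using assms(2)
  by (induction I rule: finite_induct)
    (simp_all add: lin_comb_zero_left lin_comb_add v finsum_insert)

lemma mat_column_closed [simp]:
  "v \<in> {..<n} \<rightarrow> carrier T \<Longrightarrow> mat_column T n M v i \<in> carrier T"
  by (simp add: mat_column_eq_lin_comb)

text \<open>Coefficients form a row, so passing from \<open>M v\<close> to \<open>v\<close>
  multiplies this row by \<open>M\<close> on the right.\<close>

lemma lin_comb_mat_column: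
  assumes v: "v \<in> {..<n} \<rightarrow> carrier T"
  shows "lin_comb T n x (mat_column T n M v) = lin_comb T n (\<lambda>j. \<Sum>i<n. x i * M $$ (i, j)) v"
proof -
  have "lin_comb T n x (mat_column T n M v) = (\<Oplus>i\<in>{..<n}. lin_comb T n (\<lambda>j. x i * M $$ (i, j)) v)"
    unfolding lin_comb_def[of T n x]
    by (intro finsum_cong') (auto simp: mat_column_eq_lin_comb smult_lin_comb v)
  then show ?thesis by (simp add: finsum_lin_comb v)
qed

lemma mat_column_cong:
  assumes "v \<in> {..<n} \<rightarrow> carrier T" "\<And>i. i < n \<Longrightarrow> w i = v i"
  shows "mat_column T n M w i = mat_column T n M v i"
  unfolding mat_column_eq_lin_comb using assms by (intro lin_comb_cong) auto

lemma mat_column_mult: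
  assumes "v \<in> {..<n} \<rightarrow> carrier T" "M \<in> carrier_mat n n" "N \<in> carrier_mat n n" "i < n"
  shows "mat_column T n (M * N) v i = mat_column T n M (mat_column T n N v) i"
  unfolding mat_column_eq_lin_comb[of T n M] mat_column_eq_lin_comb[of T n "M * N"]
    lin_comb_mat_column[OF assms(1)]
  using assms by (intro lin_comb_cong) (auto simp: scalar_prod_def lessThan_atLeast0)

lemma mat_column_one:
  assumes "v \<in> {..<n} \<rightarrow> carrier T" "i < n"
  shows "mat_column T n (1\<^sub>m n) v i = v i"
  unfolding mat_column_eq_lin_comb using assms lin_comb_unit[OF assms]
  by (subst lin_comb_cong[of v n _ "\<lambda>j. if i = j then 1 else 0"]) auto

lemma mat_column_add:
  assumes "v \<in> {..<n} \<rightarrow> carrier T" "M \<in> carrier_mat n n" "N \<in> carrier_mat n n" "i < n"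
  shows "mat_column T n (M + N) v i = mat_column T n M v i \<oplus> mat_column T n N v i"
  unfolding mat_column_eq_lin_comb lin_comb_add[OF assms(1), symmetric]
  using assms by (intro lin_comb_cong) auto

lemma mat_column_minus:
  assumes "v \<in> {..<n} \<rightarrow> carrier T" "M \<in> carrier_mat n n" "N \<in> carrier_mat n n" "i < n"
  shows "mat_column T n (M - N) v i = mat_column T n M v i \<ominus> mat_column T n N v i"
  unfolding mat_column_eq_lin_comb lin_comb_minus[OF assms(1), symmetric]
  using assms by (intro lin_comb_cong) auto

lemma frame_closed: "frame class_ring T n v \<Longrightarrow> v \<in> {..<n} \<rightarrow> carrier T"
  by (simp add: frame_def)

text \<open>Spanning comes from v = P(Qv), that is, from \<open>P * Q = 1\<close>. Independence
  comes from \<open>Q * P = 1\<close>: multiplying coefficient rows by \<open>Q\<close> on the right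
  is undone by \<open>P\<close>.\<close>

lemma frame_mat_column:
  assumes frame: "frame class_ring T n v"
    and PQ: "P \<in> carrier_mat n n" "Q \<in> carrier_mat n n" "P * Q = 1\<^sub>m n" "Q * P = 1\<^sub>m n"
  shows "frame class_ring T n (mat_column T n Q v)"
proof -
  note v = frame_closed[OF frame]
  let ?w = "mat_column T n Q v"
  have w: "?w \<in> {..<n} \<rightarrow> carrier T" using v by simp
  have vw: "v i = mat_column T n P ?w i" if "i < n" for i
    using mat_column_mult[OF v PQ(1,2) that] mat_column_one[OF v that] PQ(3) by simp
  have "\<exists>x. z = lin_comb T n x ?w" if z: "z \<in> carrier T" for z
  proof -
    obtain x where "z = lin_comb T n x v" using frame z unfolding frame_def by blast
    also have "\<dots> = lin_comb T n x (mat_column T n P ?w)"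
      using w vw by (intro lin_comb_cong) auto
    finally show ?thesis using lin_comb_mat_column[OF w] by auto
  qed
  moreover have "x i = y i" if xy: "lin_comb T n x ?w = lin_comb T n y ?w" and i: "i < n" for x y i
  proof -
    have *: "(\<Sum>j<n. (\<Sum>i<n. x i * Q $$ (i, j)) * P $$ (j, k)) = x k" if "k < n" for x k
    proof -
      have "(\<Sum>j<n. (\<Sum>i<n. x i * Q $$ (i, j)) * P $$ (j, k)) =
          (\<Sum>i<n. x i * (\<Sum>j<n. Q $$ (i, j) * P $$ (j, k)))"
        unfolding sum_distrib_left sum_distrib_right
        by (subst sum.swap) (simp add: mult.assoc)
      also have "\<dots> = (\<Sum>i<n. x i * (Q * P) $$ (i, k))"
        using PQ(1,2) that by (intro sum.cong) (auto simp: scalar_prod_def lessThan_atLeast0)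
      also have "\<dots> = (\<Sum>i<n. if i = k then x i else 0)"
        unfolding PQ(4) using that by (intro sum.cong) auto
      finally show ?thesis using that by simp
    qed
    have "(\<Sum>i<n. x i * Q $$ (i, j)) = (\<Sum>i<n. y i * Q $$ (i, j))" if "j < n" for j
      using frame that xy unfolding frame_def lin_comb_mat_column[OF v]
      by (auto dest!: spec[of _ j])
    then have "(\<Sum>j<n. (\<Sum>i<n. x i * Q $$ (i, j)) * P $$ (j, i)) =
        (\<Sum>j<n. (\<Sum>i<n. y i * Q $$ (i, j)) * P $$ (j, i))"
      by (intro sum.cong) auto
    then show ?thesis using i by (simp add: *)
  qed
  ultimately show ?thesis using w unfolding frame_def by auto
qed

lemma derivationD:
  assumes "derivation T \<delta>" "v \<in> carrier T" "w \<in> carrier T"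
  shows "\<delta> v \<in> carrier T" "\<delta> (v \<oplus> w) = \<delta> v \<oplus> \<delta> w" "\<delta> (v \<otimes> w) = \<delta> v \<otimes> w \<oplus> v \<otimes> \<delta> w"
  using assms by (auto simp: derivation_def)

lemma semilinear_derivationD:
  assumes "semilinear_derivation D T \<delta>" "v \<in> carrier T"
  shows "derivation T \<delta>" "\<delta> (x \<odot> v) = D x \<odot> v \<oplus> x \<odot> \<delta> v"
  using assms by (auto simp: semilinear_derivation_def)

text \<open>The terms \<open>D x \<odot> z\<close> cancel, which leaves a map linear over the whole
  field. Together with \<open>semilinear_derivation_add\<close>, this makes the semilinear
  derivations, when there are any, a torsor under the linear ones.\<close>

lemma semilinear_derivation_diff:
  assumes \<delta>: "semilinear_derivation D T \<delta>" and \<epsilon>: "semilinear_derivation D T \<epsilon>"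
  shows "derivation T (\<lambda>z. \<delta> z \<ominus> \<epsilon> z)"
    and "(\<lambda>z. \<delta> z \<ominus> \<epsilon> z) \<in> module_hom class_ring T T"
proof -
  have d: "derivation T \<delta>" "derivation T \<epsilon>" using assms by (simp_all add: semilinear_derivation_def)
  note [simp] = derivationD[OF d(1)] derivationD[OF d(2)] 
  show "derivation T (\<lambda>z. \<delta> z \<ominus> \<epsilon> z)"
    unfolding derivation_def
    by (auto simp: minus_eq l_distr r_distr l_minus r_minus minus_add a_ac)
  have "a \<oplus> b \<ominus> (a \<oplus> c) = b \<oplus> \<ominus> c" if "a \<in> carrier T" "b \<in> carrier T" "c \<in> carrier T" for a b c
    using that by (simp add: minus_eq minus_add a_comm[of a b] a_assoc r_neg2)
  then have "\<delta> (x \<odot> z) \<ominus> \<epsilon> (x \<odot> z) = x \<odot> (\<delta> z \<ominus> \<epsilon> z)" if "z \<in> carrier T" for x z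
    using that by (simp add: semilinear_derivationD(2)[OF \<delta>] semilinear_derivationD(2)[OF \<epsilon>]
      minus_eq[of "\<delta> z"] smult_add_right smult_minus_right)
  moreover have "\<delta> (z \<oplus> w) \<ominus> \<epsilon> (z \<oplus> w) = (\<delta> z \<ominus> \<epsilon> z) \<oplus> (\<delta> w \<ominus> \<epsilon> w)"
    if "z \<in> carrier T" "w \<in> carrier T" for z w
    using that by (simp add: minus_eq minus_add a_ac)
  ultimately show "(\<lambda>z. \<delta> z \<ominus> \<epsilon> z) \<in> module_hom class_ring T T"
    unfolding module_hom_def by auto
qed

lemma semilinear_derivation_add:
  assumes \<delta>: "semilinear_derivation D T \<delta>" and \<epsilon>: "derivation T \<epsilon>" "\<epsilon> \<in> module_hom class_ring T T"
  shows "semilinear_derivation D T (\<lambda>z. \<delta> z \<oplus> \<epsilon> z)"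
proof -
  have d: "derivation T \<delta>" using assms by (simp add: semilinear_derivation_def)
  note [simp] = derivationD[OF d] derivationD[OF \<epsilon>(1)]
  have "derivation T (\<lambda>z. \<delta> z \<oplus> \<epsilon> z)"
    unfolding derivation_def by (auto simp: l_distr r_distr a_ac)
  moreover have "\<epsilon> (x \<odot> z) = x \<odot> \<epsilon> z" if "z \<in> carrier T" for x z
    using module_hom_smult[OF \<epsilon>(2), of x z] that by simp
  ultimately show ?thesis
    unfolding semilinear_derivation_def
    by (auto simp: semilinear_derivationD(2)[OF \<delta>] smult_add_right a_ac)
qed

end

section \<open>Derivations of a form\<close>

text \<open>Here \<open>B\<close> plays the form inside \<open>T\<close>. The point is that one
  family \<open>w\<close> is a basis of both: with coefficients in \<open>F\<close> it spans
  \<open>B\<close>, with arbitrary ones \<open>T\<close>. The cocycle enters only when the locale is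
  interpreted.\<close>

locale descent = algebra_over_field T
  for T :: "('k::field, 't, 'x) module_scheme" (structure) +
  fixes F :: "'k set" and D :: "'k \<Rightarrow> 'k" and B :: "'t set" and n :: nat and w :: "nat \<Rightarrow> 't"
  assumes D_add: "D (x + y) = D x + D y" and D_mult: "D (x * y) = D x * y + x * D y"
    and D_closed: "x \<in> F \<Longrightarrow> D x \<in> F"
    and B_subset: "B \<subseteq> carrier T"
    and B_add: "v \<in> B \<Longrightarrow> v' \<in> B \<Longrightarrow> v \<oplus> v' \<in> B"
    and B_mult: "v \<in> B \<Longrightarrow> v' \<in> B \<Longrightarrow> v \<otimes> v' \<in> B"
    and B_smult: "x \<in> F \<Longrightarrow> v \<in> B \<Longrightarrow> x \<odot> v \<in> B"
    and B_zero: "\<zero> \<in> B" and B_one: "\<one> \<in> B"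
    and frame_w: "frame class_ring T n w"
    and w_in_B: "w \<in> {..<n} \<rightarrow> B"
    and B_span: "v \<in> B \<Longrightarrow> \<exists>x\<in>{..<n} \<rightarrow> F. v = lin_comb T n x w"
begin

abbreviation "B_alg \<equiv> T\<lparr>carrier := B\<rparr>"

lemma w_closed: "w \<in> {..<n} \<rightarrow> carrier T"
  using frame_w by (rule frame_closed)

lemma B_closed [simp]: "v \<in> B \<Longrightarrow> v \<in> carrier T"
  using B_subset by blast

text \<open>Only the values at indices below \<open>n\<close> are determined; the choice leaves the
  others arbitrary.\<close>

definition coord :: "'t \<Rightarrow> nat \<Rightarrow> 'k" where
  "coord v = (SOME x. v = lin_comb T n x w)"

lemma lin_comb_coord: "v \<in> carrier T \<Longrightarrow> lin_comb T n (coord v) w = v"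
proof -
  assume "v \<in> carrier T"
  then have "\<exists>x. v = lin_comb T n x w" using frame_w unfolding frame_def by blast
  then show ?thesis unfolding coord_def by (metis (mono_tags, lifting) someI)
qed

lemma coord_eqI:
  assumes "v = lin_comb T n x w" "i < n"
  shows "coord v i = x i"
proof -
  have "lin_comb T n (coord v) w = lin_comb T n x w"
    using lin_comb_coord[of v] assms w_closed by simp
  then show ?thesis using frame_w assms(2) unfolding frame_def by auto
qed

lemma coord_add:
  assumes "v \<in> carrier T" "v' \<in> carrier T" "i < n"
  shows "coord (v \<oplus> v') i = coord v i + coord v' i"
  using assms by (intro coord_eqI) (simp_all add: lin_comb_add w_closed lin_comb_coord)

lemma coord_in_F: "v \<in> B \<Longrightarrow> i < n \<Longrightarrow> coord v i \<in> F"
  using B_span[of v] coord_eqI[of v _ i] by fastforce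

lemma lin_comb_in_B:
  assumes "x \<in> {..<n} \<rightarrow> F" "v \<in> {..<n} \<rightarrow> B"
  shows "lin_comb T n x v \<in> B"
  unfolding lin_comb_def
  by (rule finsum_additive(1)[of T T B "\<lambda>z. z"])
    (use assms in \<open>auto simp: B_zero B_add B_smult Pi_iff intro: abelian_monoid_axioms\<close>)

text \<open>As \<open>w\<close> lies in \<open>B\<close>, the scalar multiples of elements of
  \<open>B\<close> generate \<open>T\<close> additively. This reduces additive identities on
  \<open>T\<close> to facts about \<open>B\<close>.\<close>

lemma scalar_induct [consumes 1, case_names smult add]:
  assumes "z \<in> carrier T" and smult: "\<And>x v. v \<in> B \<Longrightarrow> Z (x \<odot> v)"
    and add: "\<And>v v'. v \<in> carrier T \<Longrightarrow> v' \<in> carrier T \<Longrightarrow> Z v \<Longrightarrow> Z v' \<Longrightarrow> Z (v \<oplus> v')"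
  shows "Z z"
proof -
  \<comment> \<open>The set where \<open>Z\<close> holds is an additive submonoid; it contains zero
    as a multiple of \<zero> in \<open>B\<close>.\<close>
  have "lin_comb T n (coord z) w \<in> {v \<in> carrier T. Z v}"
    unfolding lin_comb_def
    by (rule finsum_additive(1)[of T T _ "\<lambda>z. z"])
      (use w_in_B smult smult[OF B_zero] add in \<open>auto simp: Pi_iff intro: abelian_monoid_axioms\<close>)
  then show ?thesis using lin_comb_coord[OF assms(1)] by simp
qed

text \<open>Applied to the rows of a matrix, this is the product rule \<delta>(Q v) = Q' v + Q
  \<delta>(v), the source of the derivative in the theorem.\<close>

lemma semilinear_lin_comb:
  assumes \<delta>: "semilinear_derivation D T \<delta>" and v: "v \<in> {..<n} \<rightarrow> carrier T"
  shows "\<delta> (lin_comb T n x v) = lin_comb T n (\<lambda>i. D (x i)) v \<oplus> lin_comb T n x (\<lambda>i. \<delta> (v i))"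
proof -
  have der: "derivation T \<delta>" using \<delta> by (simp add: semilinear_derivation_def)
  note d = derivationD[OF der]
  have d0: "\<delta> \<zero> = \<zero>" using d(1)[of \<zero> \<zero>] d(2)[of \<zero> \<zero>] by simp
  have \<delta>v: "(\<lambda>i. \<delta> (v i)) \<in> {..<n} \<rightarrow> carrier T" using d(1) v by (auto simp: Pi_iff)
  have "\<delta> (lin_comb T n x v) = (\<Oplus>i\<in>{..<n}. \<delta> (x i \<odot> v i))"
    unfolding lin_comb_def
    by (rule finsum_additive(2)[of T T "carrier T"])
      (use v d d0 in \<open>auto intro: abelian_monoid_axioms\<close>)
  also have "\<dots> = (\<Oplus>i\<in>{..<n}. D (x i) \<odot> v i \<oplus> x i \<odot> \<delta> (v i))"
    using v \<delta>v by (intro finsum_cong') (auto simp: semilinear_derivationD(2)[OF \<delta>] Pi_iff)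
  also have "\<dots> = lin_comb T n (\<lambda>i. D (x i)) v \<oplus> lin_comb T n x (\<lambda>i. \<delta> (v i))"
    unfolding lin_comb_def using v \<delta>v by (intro finsum_addf) auto
  finally show ?thesis .
qed

text \<open>The definition prescribes \<delta> only on the multiples of \<one>. Writing x v as the
  product of x \<one> and v, the Leibniz rule turns this into semilinearity on all of
  \<open>B\<close>.\<close>

lemma derivations_extendingD:
  assumes "\<delta> \<in> derivations_extending F D B_alg" "v \<in> B"
  shows "\<delta> v \<in> B" "v' \<in> B \<Longrightarrow> \<delta> (v \<oplus> v') = \<delta> v \<oplus> \<delta> v'"
    "v' \<in> B \<Longrightarrow> \<delta> (v \<otimes> v') = \<delta> v \<otimes> v' \<oplus> v \<otimes> \<delta> v'"
    "x \<in> F \<Longrightarrow> \<delta> (x \<odot> v) = D x \<odot> v \<oplus> x \<odot> \<delta> v"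
proof -
  note * = assms(1)[unfolded derivations_extending_def derivation_def, simplified]
  show 1: "\<delta> v \<in> B" using * assms(2) by auto
  show "\<delta> (v \<oplus> v') = \<delta> v \<oplus> \<delta> v'" if "v' \<in> B" using * assms(2) that by auto
  show "\<delta> (v \<otimes> v') = \<delta> v \<otimes> v' \<oplus> v \<otimes> \<delta> v'" if "v' \<in> B" using * assms(2) that by auto
  show "\<delta> (x \<odot> v) = D x \<odot> v \<oplus> x \<odot> \<delta> v" if x: "x \<in> F"
  proof -
    have "\<delta> (x \<odot> v) = \<delta> ((x \<odot> \<one>) \<otimes> v)"
      using assms(2) by (simp add: smult_mult)
    also have "\<dots> = \<delta> (x \<odot> \<one>) \<otimes> v \<oplus> (x \<odot> \<one>) \<otimes> \<delta> v"
      using * assms(2) x B_smult[OF x B_one] by auto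
    also have "\<delta> (x \<odot> \<one>) = D x \<odot> \<one>" using * x by auto
    finally show ?thesis using 1 assms(2) by (simp add: smult_mult)
  qed
qed

text \<open>Additivity and semilinearity force this value on a combination of \<open>w\<close>, so
  it is the only candidate. Using coordinates in \<open>w\<close> makes it a total definition with
  no choice of presentation.\<close>

definition extension :: "('t \<Rightarrow> 't) \<Rightarrow> 't \<Rightarrow> 't" where
  "extension \<delta> z =
     lin_comb T n (\<lambda>i. D (coord z i)) w \<oplus> lin_comb T n (coord z) (\<lambda>i. \<delta> (w i))"

context
  fixes \<delta> assumes \<delta>: "\<delta> \<in> derivations_extending F D B_alg"
begin

lemmas \<delta>_simps = derivations_extendingD[OF \<delta>]

lemma \<delta>_zero: "\<delta> \<zero> = \<zero>"
  using \<delta>_simps(2)[OF B_zero B_zero] \<delta>_simps(1)[OF B_zero] by simp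

lemma \<delta>_w_closed: "(\<lambda>i. \<delta> (w i)) \<in> {..<n} \<rightarrow> carrier T"
  using \<delta>_simps(1) w_in_B by (auto simp: Pi_iff)

lemma \<delta>_lin_comb:
  assumes "x \<in> {..<n} \<rightarrow> F"
  shows "\<delta> (lin_comb T n x w) = lin_comb T n (\<lambda>i. D (x i)) w \<oplus> lin_comb T n x (\<lambda>i. \<delta> (w i))"
proof -
  have "\<delta> (lin_comb T n x w) = (\<Oplus>i\<in>{..<n}. \<delta> (x i \<odot> w i))"
    unfolding lin_comb_def
    by (rule finsum_additive(2)[of T T B])
      (use assms w_in_B in \<open>auto simp: \<delta>_simps \<delta>_zero B_zero B_add B_smult Pi_iff
        intro: abelian_monoid_axioms\<close>)
  also have "\<dots> = (\<Oplus>i\<in>{..<n}. D (x i) \<odot> w i \<oplus> x i \<odot> \<delta> (w i))"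
    using assms w_in_B w_closed \<delta>_w_closed
    by (intro finsum_cong') (auto simp: \<delta>_simps Pi_iff)
  also have "\<dots> = lin_comb T n (\<lambda>i. D (x i)) w \<oplus> lin_comb T n x (\<lambda>i. \<delta> (w i))"
    unfolding lin_comb_def using w_closed \<delta>_w_closed by (intro finsum_addf) auto
  finally show ?thesis .
qed

lemma extension_closed: "extension \<delta> z \<in> carrier T"
  by (simp add: extension_def w_closed \<delta>_w_closed)

lemma extension_add:
  assumes "z \<in> carrier T" "z' \<in> carrier T"
  shows "extension \<delta> (z \<oplus> z') = extension \<delta> z \<oplus> extension \<delta> z'"
proof -
  have "lin_comb T n (\<lambda>i. D (coord (z \<oplus> z') i)) w =
      lin_comb T n (\<lambda>i. D (coord z i)) w \<oplus> lin_comb T n (\<lambda>i. D (coord z' i)) w"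
    by (subst lin_comb_add[symmetric, OF w_closed], rule lin_comb_cong[OF w_closed])
      (simp_all add: assms coord_add D_add)
  moreover have "lin_comb T n (coord (z \<oplus> z')) (\<lambda>i. \<delta> (w i)) =
      lin_comb T n (coord z) (\<lambda>i. \<delta> (w i)) \<oplus> lin_comb T n (coord z') (\<lambda>i. \<delta> (w i))"
    by (subst lin_comb_add[symmetric, OF \<delta>_w_closed], rule lin_comb_cong[OF \<delta>_w_closed])
      (simp_all add: assms coord_add)
  ultimately show ?thesis
    by (simp add: extension_def w_closed \<delta>_w_closed a_ac)
qed

text \<open>The coordinates of x v are x y_i with y_i in \<open>F\<close>, and D(x y_i) = D x y_i +
  x D(y_i). The second terms combine with the values on \<open>w\<close> to x \<delta>(v). This is
  the formula that frees later arguments from coordinates; for x = 1 it says that \<delta> is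
  extended.\<close>

lemma extension_smult_B:
  assumes "v \<in> B"
  shows "extension \<delta> (x \<odot> v) = D x \<odot> v \<oplus> x \<odot> \<delta> v"
proof -
  obtain y where y: "y \<in> {..<n} \<rightarrow> F" "v = lin_comb T n y w"
    using B_span[OF assms] by blast
  have c: "coord (x \<odot> v) i = x * y i" if "i < n" for i
    using that by (intro coord_eqI) (simp_all add: y smult_lin_comb w_closed)
  have "extension \<delta> (x \<odot> v) = lin_comb T n (\<lambda>i. D x * y i + x * D (y i)) w \<oplus>
      lin_comb T n (\<lambda>i. x * y i) (\<lambda>i. \<delta> (w i))"
    unfolding extension_def using c
    by (intro arg_cong2[where f = "add T"] lin_comb_cong w_closed \<delta>_w_closed) (simp_all add: D_mult)
  also have "\<dots> = D x \<odot> v \<oplus> x \<odot> \<delta> v"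
    unfolding y(2) \<delta>_lin_comb[OF y(1)]
    by (simp add: lin_comb_add w_closed \<delta>_w_closed smult_lin_comb smult_add_right a_assoc)
  finally show ?thesis .
qed

lemma extension_eq:
  assumes "v \<in> B"
  shows "extension \<delta> v = \<delta> v"
proof -
  have "D 1 = 0" by (metis D_mult mult_1 mult_1_right add.right_neutral add_left_imp_eq)
  then show ?thesis
    using extension_smult_B[OF assms, of 1] \<delta>_simps(1)[OF assms] assms by simp
qed

text \<open>Each law is additive in every argument from \<open>T\<close>, so
  \<open>scalar_induct\<close> reduces it to scalar multiples of elements of \<open>B\<close>. There
  the Leibniz rules of \<open>D\<close> and of \<delta> combine.\<close>

lemma semilinear_derivation_extension: "semilinear_derivation D T (extension \<delta>)"
proof -
  have smult: "extension \<delta> (x \<odot> z) = D x \<odot> z \<oplus> x \<odot> extension \<delta> z" if "z \<in> carrier T" for x z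
    using that
  proof (induction rule: scalar_induct)
    case (smult y v)
    then show ?case
      by (simp add: smult_smult extension_smult_B D_mult smult_add_left smult_add_right
        \<delta>_simps a_assoc)
  next
    case (add v v')
    then show ?case
      by (simp add: smult_add_right extension_add extension_closed a_ac)
  qed
  have mult_B: "extension \<delta> ((x \<odot> v) \<otimes> z) = extension \<delta> (x \<odot> v) \<otimes> z \<oplus> (x \<odot> v) \<otimes> extension \<delta> z"
    if "v \<in> B" "z \<in> carrier T" for x v z
    using that(2)
  proof (induction rule: scalar_induct)
    case (smult y u)
    \<comment> \<open>Collecting the scalars leaves an element of \<open>B\<close>, to which
      \<open>extension_smult_B\<close> applies.\<close>
    have eq: "(x \<odot> v) \<otimes> (y \<odot> u) = (x * y) \<odot> (v \<otimes> u)"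
      using smult that(1) by (simp add: smult_mult smult_smult mult.commute)
    show ?case
      unfolding eq extension_smult_B[OF B_mult[OF that(1) smult]] extension_smult_B[OF smult]
        extension_smult_B[OF that(1)] \<delta>_simps(3)[OF that(1) smult]
      using smult that(1) \<delta>_simps(1)
      by (simp add: D_mult l_distr r_distr smult_mult smult_smult smult_add_left smult_add_right
        mult.commute a_ac)
  next
    case (add u u')
    then show ?case
      using that(1) by (simp add: r_distr extension_add extension_closed a_ac)
  qed
  have mult: "extension \<delta> (z \<otimes> z') = extension \<delta> z \<otimes> z' \<oplus> z \<otimes> extension \<delta> z'"
    if "z \<in> carrier T" "z' \<in> carrier T" for z z'
    using that(1)
  proof (induction rule: scalar_induct)
    case (smult x v)
    then show ?case using mult_B that(2) by blast
  next
    case (add u u')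
    then show ?case
      using that(2) by (simp add: l_distr extension_add extension_closed a_ac)
  qed
  show ?thesis
    unfolding semilinear_derivation_def derivation_def
    using smult mult extension_add extension_closed by auto
qed

end

text \<open>An element of \<open>B\<close> has coordinates in \<open>F\<close>, and \<open>D\<close>
  preserves \<open>F\<close>, so it is enough to control the values on \<open>w\<close>. The
  prescribed values on multiples of \<one> follow from \<delta>(\<one>) = \<zero>.\<close>

lemma restrict_semilinear_derivation:
  assumes \<delta>: "semilinear_derivation D T \<delta>" and w: "\<And>i. i < n \<Longrightarrow> \<delta> (w i) \<in> B"
  shows "restrict \<delta> B \<in> derivations_extending F D B_alg"
proof -
  have der: "derivation T \<delta>" using \<delta> by (simp add: semilinear_derivation_def)
  note d = derivationD[OF der]
  have one: "\<delta> \<one> = \<zero>" using d(1)[of \<one> \<one>] d(3)[of \<one> \<one>] by simp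
  have "\<delta> v \<in> B" if v: "v \<in> B" for v
  proof -
    obtain x where x: "x \<in> {..<n} \<rightarrow> F" "v = lin_comb T n x w"
      using B_span[OF v] by blast
    show ?thesis
      unfolding x(2) semilinear_lin_comb[OF \<delta> w_closed] using x w_in_B w D_closed
      by (intro B_add lin_comb_in_B) (auto simp: Pi_iff)
  qed
  then show ?thesis
    unfolding derivations_extending_def derivation_def
    by (auto simp: d B_add B_mult B_one B_smult semilinear_derivationD(2)[OF \<delta>] one)
qed

lemma derivations_extending_eqI:
  assumes \<delta>: "\<delta> \<in> derivations_extending F D B_alg" and \<epsilon>: "\<epsilon> \<in> derivations_extending F D B_alg"
    and "\<And>i. i < n \<Longrightarrow> \<delta> (w i) = \<epsilon> (w i)"
  shows "\<delta> = \<epsilon>"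
proof (rule extensionalityI[of _ B])
  show "\<delta> \<in> extensional B" "\<epsilon> \<in> extensional B"
    using \<delta> \<epsilon> by (simp_all add: derivations_extending_def)
  fix v assume "v \<in> B"
  then have "extension \<delta> v = extension \<epsilon> v"
    unfolding extension_def using assms(3) \<delta>_w_closed[OF \<epsilon>]
    by (intro arg_cong2[where f = "add T"] lin_comb_cong) (auto simp: w_closed)
  then show "\<delta> v = \<epsilon> v"
    using \<open>v \<in> B\<close> extension_eq \<delta> \<epsilon> by simp
qed

text \<open>This map will be the bijection. Row i holds the coordinates of \<delta>(w i), so that
  the column \<open>w\<close> satisfies \<delta>(w) = N w.\<close>

definition derivation_matrix :: "('t \<Rightarrow> 't) \<Rightarrow> 'k mat" where
  "derivation_matrix \<delta> = mat n n (\<lambda>(i, j). coord (\<delta> (w i)) j)"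

lemma derivation_matrix_carrier: "derivation_matrix \<delta> \<in> carrier_mat n n"
  by (simp add: derivation_matrix_def)

lemma mat_column_derivation_matrix:
  assumes "\<delta> (w i) \<in> carrier T" "i < n"
  shows "mat_column T n (derivation_matrix \<delta>) w i = \<delta> (w i)"
  unfolding mat_column_eq_lin_comb using assms lin_comb_coord[OF assms(1)]
  by (subst lin_comb_cong[OF w_closed, of _ "coord (\<delta> (w i))" w])
    (auto simp: derivation_matrix_def)

lemma elements_derivation_matrix:
  assumes "\<delta> \<in> derivations_extending F D B_alg"
  shows "elements_mat (derivation_matrix \<delta>) \<subseteq> F"
  using coord_in_F derivations_extendingD(1)[OF assms] w_in_B
  by (auto simp: derivation_matrix_def elements_mat_def Pi_iff)

lemma derivation_matrix_eqI:
  assumes "N \<in> carrier_mat n n" "\<And>i. i < n \<Longrightarrow> \<delta> (w i) = mat_column T n N w i"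
  shows "derivation_matrix \<delta> = N"
  using assms coord_eqI[OF assms(2)[unfolded mat_column_eq_lin_comb]]
  by (intro eq_matI) (auto simp: derivation_matrix_def)

end

text \<open>The Lie algebra with the scalar extension and its basis column replaced by arbitrary
  data, so that the descent argument needs no tensor products.\<close>

definition linear_derivation_matrices ::
  "('k::field, 't, 'x) module_scheme \<Rightarrow> nat \<Rightarrow> (nat \<Rightarrow> 't) \<Rightarrow> 'k mat set" where
  "linear_derivation_matrices T n v =
     {M \<in> carrier_mat n n. \<exists>\<delta>\<in>module_hom class_ring T T.
        (\<forall>i<n. \<delta> (v i) = mat_column T n M v i) \<and> derivation T \<delta>}"

text \<open>\<open>d0\<close> stands for \<open>id \<otimes> D\<close>, \<open>v\<close> for the
  basis column and \<open>Q\<close> for the inverse of \<open>P\<close>. Injectivity holds because a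
  derivation is determined on \<open>w\<close>; the image is found by comparing with
  \<open>d0\<close>.\<close>

lemma (in descent) bij_betw_derivation_matrix:
  assumes d0: "semilinear_derivation D T d0" and d0_v: "\<And>i. i < n \<Longrightarrow> d0 (v i) = \<zero>"
    and v: "v \<in> {..<n} \<rightarrow> carrier T"
    and PQ: "P \<in> carrier_mat n n" "Q \<in> carrier_mat n n" "P * Q = 1\<^sub>m n" "Q * P = 1\<^sub>m n"
    and w_eq: "\<And>i. i < n \<Longrightarrow> w i = mat_column T n Q v i"
  shows "bij_betw derivation_matrix (derivations_extending F D B_alg)
    ({Q * M * P + map_mat D Q * P | M. M \<in> linear_derivation_matrices T n v}
       \<inter> {N \<in> carrier_mat n n. elements_mat N \<subseteq> F})"
proof -
  define Q' where "Q' = map_mat D Q"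
  have Q': "Q' \<in> carrier_mat n n" using PQ by (simp add: Q'_def)
  note [simp] = PQ(1,2) Q' w_closed v
  have [simp]: "X * Y \<in> carrier_mat n n" if "X \<in> carrier_mat n n" "Y \<in> carrier_mat n n"
    for X Y :: "'k mat"
    using that by (rule mult_carrier_mat)
  have v_eq: "v i = mat_column T n P w i" if "i < n" for i
  proof -
    have "mat_column T n P w i = mat_column T n P (mat_column T n Q v) i"
      using w_eq by (intro mat_column_cong) auto
    then show ?thesis using that by (simp add: mat_column_mult[symmetric] PQ(3) mat_column_one)
  qed
  \<comment> \<open>As \<open>d0\<close> kills \<open>v\<close>, only the entries of
    \<open>Q\<close> are differentiated.\<close>
  have d0_w: "d0 (w i) = mat_column T n Q' v i" if "i < n" for i
  proof -
    have "d0 (w i) = lin_comb T n (\<lambda>j. D (Q $$ (i, j))) v \<oplus>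
        lin_comb T n (\<lambda>j. Q $$ (i, j)) (\<lambda>i. d0 (v i))"
      using that by (simp add: w_eq mat_column_eq_lin_comb semilinear_lin_comb[OF d0])
    also have "lin_comb T n (\<lambda>j. Q $$ (i, j)) (\<lambda>i. d0 (v i)) = \<zero>"
      by (rule lin_comb_zero_right) (rule d0_v)
    also have "lin_comb T n (\<lambda>j. D (Q $$ (i, j))) v = mat_column T n Q' v i"
      unfolding mat_column_eq_lin_comb
      using that carrier_matD[OF PQ(2)] by (intro lin_comb_cong) (auto simp: Q'_def)
    finally show ?thesis by simp
  qed
  \<comment> \<open>Rewriting \<open>v\<close> as \<open>P w\<close> yields the summand
    \<open>Q' * P\<close>.\<close>
  have Qv: "mat_column T n Q' v i = mat_column T n (Q' * P) w i" if "i < n" for i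
    using that v_eq by (subst mat_column_mult) (auto intro!: mat_column_cong[symmetric] mat_column_cong)
  have inj: "inj_on derivation_matrix (derivations_extending F D B_alg)"
  proof (rule inj_onI)
    fix \<delta> \<epsilon> assume *: "\<delta> \<in> derivations_extending F D B_alg" "\<epsilon> \<in> derivations_extending F D B_alg"
      "derivation_matrix \<delta> = derivation_matrix \<epsilon>"
    show "\<delta> = \<epsilon>"
    proof (rule derivations_extending_eqI[OF *(1,2)])
      fix i assume "i < n"
      then have "w i \<in> B" using w_in_B by auto
      then show "\<delta> (w i) = \<epsilon> (w i)"
        using mat_column_derivation_matrix[of \<delta> i] mat_column_derivation_matrix[of \<epsilon> i] *(3) \<open>i < n\<close>
          derivations_extendingD(1)[OF *(1)] derivations_extendingD(1)[OF *(2)] by simp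
    qed
  qed
  have into: "derivation_matrix \<delta> \<in> {Q * M * P + Q' * P | M. M \<in> linear_derivation_matrices T n v}"
    if \<delta>: "\<delta> \<in> derivations_extending F D B_alg" for \<delta>
  proof -
    define N where "N = derivation_matrix \<delta>"
    \<comment> \<open>\<open>L\<close> will be the matrix of the linear derivation \<mu> in the
      basis \<open>w\<close>, and \<open>M\<close> its matrix in the basis \<open>v\<close>;
      conjugation by \<open>P\<close> changes the basis.\<close>
    define L where "L = N - Q' * P"
    define M where "M = P * L * Q"
    have N[simp]: "N \<in> carrier_mat n n" by (simp add: N_def derivation_matrix_carrier)
    have L[simp]: "L \<in> carrier_mat n n" unfolding L_def by (rule minus_carrier_mat[OF mult_carrier_mat[OF Q' PQ(1)]])
    have M[simp]: "M \<in> carrier_mat n n" by (simp add: M_def)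
    have "Q * M * P = (Q * P) * L * (Q * P)"
      by (simp add: M_def assoc_mult_mat[where ?n\<^sub>1 = n and ?n\<^sub>2 = n and ?n\<^sub>3 = n and ?n\<^sub>4 = n])
    then have "Q * M * P = L"
      unfolding PQ(4) by (simp only: left_mult_one_mat[OF L] right_mult_one_mat[OF L])
    moreover have "X = X - Y + Y" if "X \<in> carrier_mat n n" "Y \<in> carrier_mat n n" for X Y :: "'k mat"
      using carrier_matD[OF that(1)] carrier_matD[OF that(2)] by (intro eq_matI) auto
    ultimately have N_eq: "N = Q * M * P + Q' * P"
      by (simp add: L_def)
    define \<mu> where "\<mu> z = extension \<delta> z \<ominus> d0 z" for z
    note \<mu> = semilinear_derivation_diff[OF semilinear_derivation_extension[OF \<delta>] d0, folded \<mu>_def]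
    have \<mu>_w: "\<mu> (w i) = mat_column T n L w i" if i: "i < n" for i
    proof -
      have "w i \<in> B" using w_in_B i by auto
      then have "extension \<delta> (w i) = mat_column T n N w i"
        using mat_column_derivation_matrix[OF _ i] derivations_extendingD(1)[OF \<delta>]
        by (simp add: N_def extension_eq[OF \<delta>])
      then show ?thesis
        using i by (simp add: \<mu>_def d0_w Qv L_def mat_column_minus)
    qed
    have "\<mu> (v i) = mat_column T n M v i" if i: "i < n" for i
    proof -
      have "\<mu> (v i) = mat_column T n P (\<lambda>i. \<mu> (w i)) i"
        using i by (simp add: v_eq mat_column_eq_lin_comb module_hom_lin_comb[OF \<mu>(2)])
      also have "\<dots> = mat_column T n P (mat_column T n L w) i"
        using \<mu>_w by (intro mat_column_cong) auto
      also have "\<dots> = mat_column T n (P * L) w i"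
        using i by (simp add: mat_column_mult)
      also have "\<dots> = mat_column T n (P * L) (mat_column T n Q v) i"
        using w_eq by (intro mat_column_cong) auto
      also have "\<dots> = mat_column T n M v i"
        using i by (simp add: M_def mat_column_mult[of v n "P * L" Q])
      finally show ?thesis .
    qed
    then have "M \<in> linear_derivation_matrices T n v"
      unfolding linear_derivation_matrices_def using \<mu> by auto
    then show ?thesis using N_eq unfolding N_def by blast
  qed
  have onto: "Q * M * P + Q' * P \<in> derivation_matrix ` derivations_extending F D B_alg"
    if M: "M \<in> linear_derivation_matrices T n v" and N: "elements_mat (Q * M * P + Q' * P) \<subseteq> F" for M
  proof -
    define N where "N = Q * M * P + Q' * P"
    obtain \<mu> where \<mu>: "\<mu> \<in> module_hom class_ring T T" "derivation T \<mu>"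
      and \<mu>_v: "\<And>i. i < n \<Longrightarrow> \<mu> (v i) = mat_column T n M v i"
      and M_carrier[simp]: "M \<in> carrier_mat n n"
      using M unfolding linear_derivation_matrices_def by blast
    have N_carrier: "N \<in> carrier_mat n n" by (simp add: N_def)
    \<comment> \<open>The inverse construction: add the linear derivation of \<open>M\<close> to
      \<open>d0\<close>, then restrict to \<open>B\<close>.\<close>
    define \<delta> where "\<delta> z = d0 z \<oplus> \<mu> z" for z
    have \<delta>: "semilinear_derivation D T \<delta>"
      using semilinear_derivation_add[OF d0 \<mu>(2,1)] by (simp add: \<delta>_def[abs_def])
    have \<delta>_w: "\<delta> (w i) = mat_column T n N w i" if i: "i < n" for i
    proof -
      have "\<mu> (w i) = mat_column T n Q (\<lambda>i. \<mu> (v i)) i"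
        unfolding w_eq[OF i] mat_column_eq_lin_comb[of T n Q] by (rule module_hom_lin_comb[OF \<mu>(1) v])
      also have "\<dots> = mat_column T n Q (mat_column T n M v) i"
        using \<mu>_v by (intro mat_column_cong) auto
      also have "\<dots> = mat_column T n (Q * M) v i"
        using i by (simp add: mat_column_mult)
      also have "\<dots> = mat_column T n (Q * M) (mat_column T n P w) i"
        using v_eq by (intro mat_column_cong) auto
      also have "\<dots> = mat_column T n (Q * M * P) w i"
        using i by (simp add: mat_column_mult[of w n "Q * M" P])
      finally show ?thesis
        using i by (simp add: \<delta>_def d0_w Qv N_def mat_column_add a_comm)
    qed
    \<comment> \<open>This is where the intersection with matrices over \<open>F\<close> matters: it
      keeps the values on \<open>w\<close> inside \<open>B\<close>.\<close>
    have "N $$ (i, j) \<in> F" if "i < n" "j < n" for i j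
      using N elements_matI[OF N_carrier that refl] unfolding N_def[symmetric] by blast
    then have "\<delta> (w i) \<in> B" if "i < n" for i
      using that by (auto simp: \<delta>_w mat_column_eq_lin_comb intro!: lin_comb_in_B w_in_B)
    then have "restrict \<delta> B \<in> derivations_extending F D B_alg"
      by (rule restrict_semilinear_derivation[OF \<delta>])
    moreover have "derivation_matrix (restrict \<delta> B) = N"
      using \<delta>_w w_in_B by (intro derivation_matrix_eqI[OF N_carrier]) auto
    ultimately show ?thesis unfolding N_def[symmetric] by blast
  qed
  show ?thesis
    unfolding bij_betw_def Q'_def[symmetric]
    using inj into onto elements_derivation_matrix derivation_matrix_carrier
    by (auto simp del: v)
qed

section \<open>The scalar extension and the twisted form\<close>

text \<open>\<open>mat_inverse\<close> succeeds exactly on units of \<open>ring_mat\<close>. The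
  inverse supplied by \<open>invertible_mat\<close> comes without dimensions, which are read off
  from the identity matrices before it can witness a unit.\<close>

lemma mat_inv_props:
  assumes "P \<in> carrier_mat n n" "invertible_mat P"
  shows "mat_inv P \<in> carrier_mat n n" "P * mat_inv P = 1\<^sub>m n" "mat_inv P * P = 1\<^sub>m n"
proof -
  obtain Q where "inverts_mat P Q" "inverts_mat Q P"
    using assms(2) by (auto simp: invertible_mat_def)
  then have Q: "P * Q = 1\<^sub>m n" "Q * P = 1\<^sub>m (dim_row Q)"
    using assms(1) by (auto simp: inverts_mat_def)
  have "dim_row Q = n" "dim_col Q = n"
    using arg_cong[OF Q(1), of dim_col] arg_cong[OF Q(2), of dim_col] assms(1) by simp_all
  then have "Q \<in> carrier_mat n n" "Q * P = 1\<^sub>m n" using Q by auto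
  then have "P \<in> Units (ring_mat TYPE('a) n ())"
    using Q assms(1) by (auto simp: Units_def ring_mat_def)
  then obtain R where R: "mat_inverse P = Some R"
    using mat_inverse(1)[OF assms(1), of "()"] by fastforce
  then show "mat_inv P \<in> carrier_mat n n" "P * mat_inv P = 1\<^sub>m n" "mat_inv P * P = 1\<^sub>m n"
    using mat_inverse(2)[OF assms(1) R] by auto
qed

section \<open>Subfields, and the whole field as an algebra over them\<close>

lemma class_algebra_simps [simp]:
  "carrier class_algebra = UNIV" "mult class_algebra = (*)" "one class_algebra = 1"
  "ring.zero class_algebra = 0" "add class_algebra = (+)" "smult class_algebra = (*)"
  by (simp_all add: class_algebra_def)

lemma cring_class_algebra: "cring (class_algebra :: ('k::field, 'k) module)"
proof (rule cringI)
  show "abelian_group (class_algebra :: ('k, 'k) module)"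
    by (rule abelian_groupI) (auto simp: add.assoc add.commute intro: exI[of _ "- _"])
  show "Group.comm_monoid (class_algebra :: ('k, 'k) module)"
    by (rule comm_monoidI) (auto simp: mult.assoc mult.commute)
qed (simp add: distrib_right)

context
  fixes L :: "'k::field set"
  assumes subfield: "subfield L (class_ring :: 'k ring)"
begin

lemma subfield_closed:
  "0 \<in> L" "1 \<in> L" "x \<in> L \<Longrightarrow> y \<in> L \<Longrightarrow> x + y \<in> L" "x \<in> L \<Longrightarrow> - x \<in> L"
  "x \<in> L \<Longrightarrow> y \<in> L \<Longrightarrow> x * y \<in> L"
  using subringE[OF subfieldE(1)[OF subfield]] by (auto simp: class_ring_simps)

lemma subfield_inverse:
  assumes "x \<in> L" "x \<noteq> 0"
  shows "inverse x \<in> L"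
proof -
  let ?y = "inv\<^bsub>class_ring\<^esub> x"
  have "?y \<in> L" "x * ?y = 1"
    using ring.subfield_m_inv[OF class_ring.ring_axioms subfield, of x] assms by auto
  then show ?thesis by (metis inverse_unique)
qed

lemma field_subfield_ring: "Ring.field (subfield_ring L)"
  by (rule ring.subfield_iff(2)[OF class_ring.ring_axioms subfield])

lemma algebra_class_algebra: "algebra (subfield_ring L) class_algebra"
proof (rule algebraI)
  show "cring (subfield_ring L)"
    using field_subfield_ring by (simp add: field_def domain_def)
qed (simp_all add: cring_class_algebra algebra_simps)

end

lemma subfieldI_class_ring:
  fixes L :: "'k::field set"
  assumes "0 \<in> L" "1 \<in> L" "\<And>x y. x \<in> L \<Longrightarrow> y \<in> L \<Longrightarrow> x + y \<in> L" "\<And>x. x \<in> L \<Longrightarrow> - x \<in> L"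
    and "\<And>x y. x \<in> L \<Longrightarrow> y \<in> L \<Longrightarrow> x * y \<in> L" "\<And>x. x \<in> L \<Longrightarrow> x \<noteq> 0 \<Longrightarrow> inverse x \<in> L"
  shows "subfield L (class_ring :: 'k ring)"
proof -
  have field: "Ring.field (class_ring :: 'k ring)" ..
  have "subring L (class_ring :: 'k ring)"
    by (rule ring.subringI[OF class_ring.ring_axioms]) (use assms in \<open>auto simp: class_ring_simps\<close>)
  moreover have "inv\<^bsub>class_ring\<^esub> x \<in> L" if "x \<in> L - {0}" for x
  proof -
    have "inv\<^bsub>class_ring\<^esub> x = inverse x"
      using that by (intro monoid.inv_char[OF ring.is_monoid[OF class_ring.ring_axioms]]) auto
    then show ?thesis using assms(6) that by simp
  qed
  ultimately show ?thesis
    using field.subfieldI'[OF field, of L] by simp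
qed

text \<open>For inverses, 0 = D(x x^-1) = x D(x^-1) when \<open>x\<close> is a nonzero
  constant.\<close>

lemma subfield_constants:
  fixes F :: "'k::field set"
  assumes F: "subfield F (class_ring :: 'k ring)"
    and add: "\<And>x y. D (x + y) = D x + D y" and mult: "\<And>x y. D (x * y) = D x * y + x * D y"
  shows "subfield {x \<in> F. D x = 0} (class_ring :: 'k ring)"
proof (rule subfieldI_class_ring)
  note [simp] = subfield_closed[OF F]
  have zero: "D 0 = 0" by (metis add add.right_neutral add_left_imp_eq)
  have one: "D 1 = 0" by (metis mult mult_1 mult_1_right add.right_neutral add_left_imp_eq)
  show "0 \<in> {x \<in> F. D x = 0}" "1 \<in> {x \<in> F. D x = 0}" by (simp_all add: zero one)
  fix x assume x: "x \<in> {x \<in> F. D x = 0}"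
  have "D (- x) = 0" using add[of x "- x"] zero x by simp
  then show "- x \<in> {x \<in> F. D x = 0}" using x by simp
  { assume "x \<noteq> 0"
    then have "D (inverse x) = 0" using mult[of x "inverse x"] one x by simp
    then show "inverse x \<in> {x \<in> F. D x = 0}" using x \<open>x \<noteq> 0\<close> subfield_inverse[OF F] by simp }
  fix y assume "y \<in> {x \<in> F. D x = 0}"
  then show "x + y \<in> {x \<in> F. D x = 0}" "x * y \<in> {x \<in> F. D x = 0}"
    using x by (simp_all add: add mult)
qed

section \<open>Coordinates on the scalar extension\<close>

locale scalar_extension =
  fixes C :: "'k::field set" and A :: "('k, 'a) module" and n :: nat and e :: "nat \<Rightarrow> 'a"
  assumes subfield_C: "subfield C (class_ring :: 'k ring)"
    and A: "assoc_algebra (subfield_ring C) A"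
    and frame_e: "frame (subfield_ring C) A n e"
begin

text \<open>Otherwise the simplifier turns \<open>subfield_ring C\<close> into a record literal, and facts about the
  tensor product no longer match.\<close>

declare partial_object.update_convs [simp del]

sublocale tensor_product "subfield_ring C" A class_algebra
  by (rule tensor_product.intro[OF A algebra_class_algebra[OF subfield_C]])

text \<open>The tensor product takes its scalars from \<open>class_algebra\<close>, a record with a
  module structure over \<open>C\<close>, whereas the linear algebra above is over
  \<open>class_ring\<close>. The ring operations of the two agree.\<close>

sublocale K: algebra_over_field T
proof
  have "Module.module class_ring T"
    using module_tensor unfolding module_def Module.module_axioms_def
    by (simp add: class_cring.cring_axioms)
  then show "assoc_algebra class_ring T"
    using assoc_algebra_tensor by (simp add: assoc_algebra_def)
qed

lemma e_closed: "e \<in> {..<n} \<rightarrow> carrier A"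
  using frame_e by (simp add: frame_def)

abbreviation "V \<equiv> basis_column C A e"

lemma V_closed: "V \<in> {..<n} \<rightarrow> carrier T"
  using e_closed by (auto simp: basis_column_def Pi_iff)

text \<open>Coefficients in \<open>C\<close> cross the tensor sign by balancing and become
  scalars.\<close>

lemma pure_lin_comb:
  assumes "x \<in> {..<n} \<rightarrow> C"
  shows "pt (lin_comb A n x e) s = lin_comb T n (\<lambda>i. x i * s) V"
proof -
  have mem: "x i \<odot>\<^bsub>A\<^esub> e i \<in> carrier A" if "i < n" for i
    using assms e_closed that AM.smult_closed by (auto simp: Pi_iff)
  have "pt (lin_comb A n x e) s = (\<Oplus>\<^bsub>T\<^esub>i\<in>{..<n}. pt (x i \<odot>\<^bsub>A\<^esub> e i) s)"
    unfolding lin_comb_def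
    by (rule finsum_additive(2)[of A T "carrier A" "\<lambda>a. pt a s"])
      (use mem in \<open>auto simp: pure_add_left intro: A.abelian_monoid_axioms T.abelian_monoid_axioms\<close>)
  also have "\<dots> = lin_comb T n (\<lambda>i. x i * s) V"
    unfolding lin_comb_def
    using assms e_closed
    by (intro T.finsum_cong') (auto simp: pure_balanced pure_smult basis_column_def Pi_iff)
  finally show ?thesis .
qed

text \<open>The coefficients are chosen in \<open>C\<close>, since the frame \<open>e\<close> gives
  uniqueness only among those.\<close>

definition coord_A :: "'a \<Rightarrow> nat \<Rightarrow> 'k" where
  "coord_A a = (SOME x. x \<in> {..<n} \<rightarrow> C \<and> a = lin_comb A n x e)"

lemma coord_A:
  assumes "a \<in> carrier A"
  shows "coord_A a \<in> {..<n} \<rightarrow> C" "lin_comb A n (coord_A a) e = a"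
proof -
  have "\<exists>x. x \<in> {..<n} \<rightarrow> C \<and> a = lin_comb A n x e"
    using frame_e assms unfolding frame_def by fastforce
  from someI_ex[OF this] show "coord_A a \<in> {..<n} \<rightarrow> C" "lin_comb A n (coord_A a) e = a"
    unfolding coord_A_def by auto
qed

lemma coord_A_eqI:
  assumes "x \<in> {..<n} \<rightarrow> C" "a = lin_comb A n x e" "i < n"
  shows "coord_A a i = x i"
proof -
  have "a \<in> carrier A"
    unfolding assms(2) using AM.lin_comb_closed[OF e_closed, of x] assms(1) by simp
  from coord_A[OF this] show ?thesis
    using frame_e assms unfolding frame_def by simp
qed

text \<open>This functional detects the k-th coefficient and so proves independence of
  \<open>V\<close>. It respects balancing because the k-th coordinate on \<open>A\<close> is linear
  over \<open>C\<close>.\<close>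

lemma coordinate_functional:
  assumes k: "k < n"
  obtains g where "g \<in> carrier T \<rightarrow> (UNIV :: 'k set)"
    "\<And>x y. x \<in> carrier T \<Longrightarrow> y \<in> carrier T \<Longrightarrow> g (x \<oplus>\<^bsub>T\<^esub> y) = g x + g y"
    "\<And>a s. a \<in> carrier A \<Longrightarrow> g (pt a s) = coord_A a k * s"
proof -
  have add: "coord_A (a \<oplus>\<^bsub>A\<^esub> b) k = coord_A a k + coord_A b k"
    if ab: "a \<in> carrier A" "b \<in> carrier A" for a b
  proof (rule coord_A_eqI[OF _ _ k])
    show "(\<lambda>i. coord_A a i + coord_A b i) \<in> {..<n} \<rightarrow> C"
      using coord_A(1)[OF ab(1)] coord_A(1)[OF ab(2)] subfield_closed(3)[OF subfield_C]
      by (auto simp: Pi_iff)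
    show "a \<oplus>\<^bsub>A\<^esub> b = lin_comb A n (\<lambda>i. coord_A a i + coord_A b i) e"
      using AM.lin_comb_add[OF e_closed, of "coord_A a" "coord_A b"] coord_A ab by simp
  qed
  have smult: "coord_A (r \<odot>\<^bsub>A\<^esub> a) k = r * coord_A a k"
    if ra: "r \<in> C" "a \<in> carrier A" for r a
  proof (rule coord_A_eqI[OF _ _ k])
    show "(\<lambda>i. r * coord_A a i) \<in> {..<n} \<rightarrow> C"
      using coord_A(1)[OF ra(2)] ra(1) subfield_closed(5)[OF subfield_C] by (auto simp: Pi_iff)
    show "r \<odot>\<^bsub>A\<^esub> a = lin_comb A n (\<lambda>i. r * coord_A a i) e"
      using AM.smult_lin_comb[OF e_closed, of "coord_A a" r] coord_A ra by simp
  qed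
  have "abelian_group (class_ring :: 'k ring)" ..
  then obtain g where "g \<in> carrier T \<rightarrow> carrier (class_ring :: 'k ring)"
    "\<And>x y. x \<in> carrier T \<Longrightarrow> y \<in> carrier T \<Longrightarrow> g (x \<oplus>\<^bsub>T\<^esub> y) = g x \<oplus>\<^bsub>class_ring\<^esub> g y"
    "\<And>a s. a \<in> carrier A \<Longrightarrow> s \<in> carrier class_algebra \<Longrightarrow> g (pt a s) = coord_A a k * s"
    by (rule tensor_universal[where b = "\<lambda>a s. coord_A a k * s"])
      (auto simp: add smult algebra_simps)
  then show thesis by (intro that[of g]) auto
qed

lemma frame_V: "frame class_ring T n V"
proof -
  have "\<exists>x. z = lin_comb T n x V" if "z \<in> carrier T" for z
    using that
  proof (induction rule: tensor_induct)
    case (pure a s)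
    then show ?case using pure_lin_comb[OF coord_A(1)] coord_A(2) by metis
  next
    case (add x y)
    then obtain p q where "x = lin_comb T n p V" "y = lin_comb T n q V" by blast
    then show ?case
      by (intro exI[of _ "\<lambda>i. p i + q i"]) (simp only: K.lin_comb_add[OF V_closed])
  qed
  moreover have "x k = y k" if eq: "lin_comb T n x V = lin_comb T n y V" and k: "k < n" for x y k
  proof -
    obtain g where "g \<in> carrier T \<rightarrow> (UNIV :: 'k set)"
      and add: "\<And>x y. x \<in> carrier T \<Longrightarrow> y \<in> carrier T \<Longrightarrow> g (x \<oplus>\<^bsub>T\<^esub> y) = g x + g y"
      and pure: "\<And>a s. a \<in> carrier A \<Longrightarrow> g (pt a s) = coord_A a k * s"
      by (rule coordinate_functional[OF k], rule that)
    have "g \<zero>\<^bsub>T\<^esub> = g \<zero>\<^bsub>T\<^esub> + g \<zero>\<^bsub>T\<^esub>"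
      using add[OF T.zero_closed T.zero_closed] by (simp only: T.l_zero[OF T.zero_closed])
    then have zero: "g \<zero>\<^bsub>T\<^esub> = 0" by (metis add.right_neutral add_left_imp_eq)
    \<comment> \<open>The unit coefficients 0 and 1 lie in \<open>C\<close>, as uniqueness of
      coordinates requires.\<close>
    have coord_e: "coord_A (e i) k = (if i = k then 1 else 0)" if "i < n" for i
    proof -
      have "e i = lin_comb A n (\<lambda>j. if i = j then 1 else 0) e"
        using AM.lin_comb_unit[OF e_closed that] by (simp cong: if_cong)
      from coord_A_eqI[OF _ this k] show ?thesis
        using subfield_closed[OF subfield_C] by auto
    qed
    have V: "g (x i \<odot>\<^bsub>T\<^esub> V i) = (if i = k then x i else 0)" if "i < n" for x :: "nat \<Rightarrow> 'k" and i
      using e_closed that coord_e[OF that] by (auto simp: basis_column_def pure_smult pure Pi_iff)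
    have "g (lin_comb T n x V) = x k" for x :: "nat \<Rightarrow> 'k"
    proof -
      have "g (lin_comb T n x V) = (\<Oplus>\<^bsub>class_ring\<^esub>i\<in>{..<n}. g (x i \<odot>\<^bsub>T\<^esub> V i))"
        unfolding lin_comb_def
        by (rule finsum_additive(2)[of T class_ring "carrier T"])
          (use V_closed add zero in \<open>auto simp: Pi_iff
             intro: T.abelian_monoid_axioms
               abelian_group.axioms(1)[OF ring.is_abelian_group[OF class_ring.ring_axioms]]\<close>)
      also have "\<dots> = (\<Sum>i<n. g (x i \<odot>\<^bsub>T\<^esub> V i))" by (simp add: class_ring_simps)
      also have "\<dots> = (\<Sum>i<n. if i = k then x i else 0)" using V by (intro sum.cong) auto
      finally show ?thesis using k by simp
    qed
    then show ?thesis using eq by metis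
  qed
  ultimately show ?thesis
    using V_closed unfolding frame_def by auto
qed

section \<open>Maps of the scalar extension induced by \<open>C\<close>-linear maps of the
  field\<close>

context
  fixes h :: "'k \<Rightarrow> 'k"
  assumes h_add: "\<And>x y. h (x + y) = h x + h y" and h_C: "\<And>r x. r \<in> C \<Longrightarrow> h (r * x) = r * h x"
begin

interpretation th: tensor_hom "subfield_ring C" A class_algebra class_algebra h
  by unfold_locales (simp add: module_hom_def h_add h_C)

abbreviation (input) "ext_h \<equiv> tensor_map (subfield_ring C) A class_algebra class_algebra h"

text \<open>On pure tensors both laws are the Leibniz rule of \<open>h\<close> in the second factor;
  additivity gives the rest. The basis column has second factor 1, and
  \<open>h 1 = 0\<close>.\<close>

lemma semilinear_derivation_tensor_map:
  assumes mult: "\<And>x y. h (x * y) = h x * y + x * h y"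
  shows "semilinear_derivation h T ext_h" "i < n \<Longrightarrow> ext_h (V i) = \<zero>\<^bsub>T\<^esub>"
proof -
  note simps = th.tensor_map_closed th.tensor_map_add th.tensor_map_pure
    tensor_mult_closed tensor_l_distr tensor_r_distr pure_mult
  have 1: "ext_h (pt a s \<otimes>\<^bsub>T\<^esub> y) = ext_h (pt a s) \<otimes>\<^bsub>T\<^esub> y \<oplus>\<^bsub>T\<^esub> pt a s \<otimes>\<^bsub>T\<^esub> ext_h y"
    if "a \<in> carrier A" "y \<in> carrier T" for a s y
    using that(2)
  proof (induction rule: tensor_induct)
    case (pure b t)
    then show ?case using that(1) by (simp add: simps mult pure_add_right[symmetric])
  next
    case (add u v)
    then show ?case using that(1)
      by (simp add: simps T.a_ac del: th.tensor_map_pure)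
  qed
  have "ext_h (x \<otimes>\<^bsub>T\<^esub> y) = ext_h x \<otimes>\<^bsub>T\<^esub> y \<oplus>\<^bsub>T\<^esub> x \<otimes>\<^bsub>T\<^esub> ext_h y"
    if "x \<in> carrier T" "y \<in> carrier T" for x y
    using that(1)
  proof (induction rule: tensor_induct)
    case (pure a s)
    then show ?case using 1 that(2) by simp
  next
    case (add u v)
    then show ?case using that(2) by (simp add: simps T.a_ac)
  qed
  moreover have "ext_h (x \<odot>\<^bsub>T\<^esub> z) = h x \<odot>\<^bsub>T\<^esub> z \<oplus>\<^bsub>T\<^esub> x \<odot>\<^bsub>T\<^esub> ext_h z"
    if "z \<in> carrier T" for x z
    using that
  proof (induction rule: tensor_induct)
    case (pure a s)
    then show ?case by (simp add: th.tensor_map_pure pure_smult mult pure_add_right[symmetric])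
  next
    case (add u v)
    then show ?case by (simp add: K.smult_add_right simps T.a_ac)
  qed
  ultimately show "semilinear_derivation h T ext_h"
    unfolding semilinear_derivation_def derivation_def
    using th.tensor_map_closed th.tensor_map_add by auto
  have "h 1 = 0" by (metis mult mult_1 mult_1_right add.right_neutral add_left_imp_eq)
  then show "ext_h (V i) = \<zero>\<^bsub>T\<^esub>" if "i < n"
    using e_closed that pure_zero(2)[of "e i"] by (auto simp: basis_column_def th.tensor_map_pure Pi_iff)
qed

text \<open>Meant for Galois automorphisms, whose action on the scalar extension is multiplicative
  but twists scalars by \<open>h\<close>.\<close>

lemma semilinear_hom_tensor_map:
  assumes mult: "\<And>x y. h (x * y) = h x * h y" and one: "h 1 = 1"
  shows "ext_h \<in> Ring.ring_hom T T" "z \<in> carrier T \<Longrightarrow> ext_h (x \<odot>\<^bsub>T\<^esub> z) = h x \<odot>\<^bsub>T\<^esub> ext_h z"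
proof -
  note simps = th.tensor_map_closed th.tensor_map_add th.tensor_map_pure
    tensor_mult_closed tensor_l_distr tensor_r_distr pure_mult
  have 1: "ext_h (pt a s \<otimes>\<^bsub>T\<^esub> y) = ext_h (pt a s) \<otimes>\<^bsub>T\<^esub> ext_h y"
    if "a \<in> carrier A" "y \<in> carrier T" for a s y
    using that(2) by (induction rule: tensor_induct) (simp_all add: that(1) simps mult)
  have "ext_h (x \<otimes>\<^bsub>T\<^esub> y) = ext_h x \<otimes>\<^bsub>T\<^esub> ext_h y" if "x \<in> carrier T" "y \<in> carrier T" for x y
    using that(1)
  proof (induction rule: tensor_induct)
    case (pure a s)
    then show ?case using 1 that(2) by simp
  next
    case (add u v)
    then show ?case using that(2) by (simp add: simps)
  qed
  then show "ext_h \<in> Ring.ring_hom T T"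
    by (intro ring_hom_memI) (simp_all add: simps one_eq_pure one)
  show "ext_h (x \<odot>\<^bsub>T\<^esub> z) = h x \<odot>\<^bsub>T\<^esub> ext_h z" if "z \<in> carrier T" for x z
    using that by (induction rule: tensor_induct)
      (simp_all add: simps pure_smult mult K.smult_add_right)
qed

end

section \<open>The twisted form as an \<open>F\<close>-subalgebra\<close>

context
  fixes F :: "'k set" and f
  assumes F: "subfield F (class_ring :: 'k ring)" and C_subset: "C \<subseteq> F"
    and f: "f \<in> galois_group F \<rightarrow> aut_points (subfield_ring C) A class_algebra"
begin

abbreviation (input) "A_f \<equiv> twisted_form F C A f"

text \<open>A linear automorphism follows a \<sigma>-semilinear ring map, and \<sigma> fixes
  \<open>F\<close>. Common fixed points of such operators therefore form an
  \<open>F\<close>-subalgebra.\<close>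

lemma twisted_action:
  assumes \<sigma>: "\<sigma> \<in> galois_group F"
  defines "\<rho> \<equiv> \<lambda>z. f \<sigma> (galois_act C A \<sigma> z)"
  shows "\<rho> \<in> Ring.ring_hom T T" "x \<in> F \<Longrightarrow> z \<in> carrier T \<Longrightarrow> \<rho> (x \<odot>\<^bsub>T\<^esub> z) = x \<odot>\<^bsub>T\<^esub> \<rho> z"
proof -
  have hom: "\<sigma> \<in> Ring.ring_hom class_ring class_ring" and fix_F: "\<And>x. x \<in> F \<Longrightarrow> \<sigma> x = x"
    using \<sigma> by (auto simp: galois_group_def ring_iso_def)
  have add: "\<sigma> (x + y) = \<sigma> x + \<sigma> y" and mult: "\<sigma> (x * y) = \<sigma> x * \<sigma> y" and one: "\<sigma> 1 = 1" for x y
    using ring_hom_add[OF hom] ring_hom_mult[OF hom] ring_hom_one[OF hom] by simp_all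
  have "\<sigma> (r * x) = r * \<sigma> x" if "r \<in> C" for r x
    using that C_subset fix_F by (auto simp: mult)
  note act = semilinear_hom_tensor_map[of \<sigma>, OF add this mult one, folded galois_act_def]
  have f_hom: "f \<sigma> \<in> Ring.ring_hom T T" and f_lin: "f \<sigma> \<in> module_hom class_algebra T T"
    using f \<sigma> by (auto simp: aut_points_def ring_iso_def)
  show "\<rho> \<in> Ring.ring_hom T T"
    unfolding \<rho>_def using ring_hom_trans[OF act(1) f_hom] by (simp add: comp_def)
  show "\<rho> (x \<odot>\<^bsub>T\<^esub> z) = x \<odot>\<^bsub>T\<^esub> \<rho> z" if "x \<in> F" "z \<in> carrier T"
    using that fix_F module_hom_smult[OF f_lin, of x "galois_act C A \<sigma> z"] ring_hom_closed[OF act(1)]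
    by (simp add: \<rho>_def act(2))
qed

lemma twisted_form_alt:
  "A_f = T\<lparr>carrier := carrier A_f\<rparr>" "carrier A_f \<subseteq> carrier T"
  by (auto simp: twisted_form_def)

lemma twisted_form_closed:
  "v \<in> carrier A_f \<Longrightarrow> v' \<in> carrier A_f \<Longrightarrow> v \<oplus>\<^bsub>T\<^esub> v' \<in> carrier A_f"
  "v \<in> carrier A_f \<Longrightarrow> v' \<in> carrier A_f \<Longrightarrow> v \<otimes>\<^bsub>T\<^esub> v' \<in> carrier A_f"
  "x \<in> F \<Longrightarrow> v \<in> carrier A_f \<Longrightarrow> x \<odot>\<^bsub>T\<^esub> v \<in> carrier A_f"
  "\<one>\<^bsub>T\<^esub> \<in> carrier A_f" "\<zero>\<^bsub>T\<^esub> \<in> carrier A_f"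
proof -
  note hom = twisted_action(1)
  have mem: "v \<in> carrier A_f \<longleftrightarrow>
      v \<in> carrier T \<and> (\<forall>\<sigma>\<in>galois_group F. f \<sigma> (galois_act C A \<sigma> v) = v)" for v
    by (simp add: twisted_form_def)
  show "v \<oplus>\<^bsub>T\<^esub> v' \<in> carrier A_f" if "v \<in> carrier A_f" "v' \<in> carrier A_f"
    using that ring_hom_add[OF hom] unfolding mem by simp
  show "v \<otimes>\<^bsub>T\<^esub> v' \<in> carrier A_f" if "v \<in> carrier A_f" "v' \<in> carrier A_f"
    using that ring_hom_mult[OF hom] unfolding mem by simp
  show smult: "x \<odot>\<^bsub>T\<^esub> v \<in> carrier A_f" if "x \<in> F" "v \<in> carrier A_f" for x v
    using that twisted_action(2) unfolding mem by simp
  show one: "\<one>\<^bsub>T\<^esub> \<in> carrier A_f"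
    using ring_hom_one[OF hom] unfolding mem by simp
  show "\<zero>\<^bsub>T\<^esub> \<in> carrier A_f"
    using smult[OF subfield_closed(1)[OF F] one] by simp
qed

lemma vectorspace_twisted_form: "vectorspace (subfield_ring F) A_f"
proof -
  note closed = twisted_form_closed
  have sub: "v \<in> carrier T" if "v \<in> carrier A_f" for v using that twisted_form_alt(2) by blast
  have eqs: "add A_f = add T" "ring.zero A_f = ring.zero T" "smult A_f = smult T"
    by (simp_all add: twisted_form_def)
  have "abelian_group A_f"
  proof (rule abelian_groupI, unfold eqs)
    fix v assume v: "v \<in> carrier A_f"
    \<comment> \<open>Negation is multiplication by -1, which lies in \<open>F\<close>, so closure
      under scalars provides the additive inverses.\<close>
    have "(- 1) \<odot>\<^bsub>T\<^esub> v \<oplus>\<^bsub>T\<^esub> v = \<zero>\<^bsub>T\<^esub>"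
      using sub[OF v] K.smult_minus_left[of v 1] by (simp add: T.l_neg)
    then show "\<exists>v'\<in>carrier A_f. v' \<oplus>\<^bsub>T\<^esub> v = \<zero>\<^bsub>T\<^esub>"
      using closed(3)[OF _ v] subfield_closed[OF F] by blast
  qed (auto simp: closed sub T.a_ac)
  moreover have "cring (subfield_ring F)"
    using field_subfield_ring[OF F] by (simp add: field_def domain_def)
  ultimately have "Module.module (subfield_ring F) A_f"
    by (intro Module.moduleI)
      (auto simp: eqs closed sub K.smult_add_left K.smult_add_right K.smult_smult)
  then show ?thesis
    using field_subfield_ring[OF F] by (simp add: vectorspace_def)
qed

lemma twisted_form_span:
  assumes basis: "indexed_basis (subfield_ring F) A_f n w" and v: "v \<in> carrier A_f"
  shows "\<exists>x\<in>{..<n} \<rightarrow> F. v = lin_comb T n x w"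
proof -
  interpret A_f: vectorspace "subfield_ring F" A_f by (rule vectorspace_twisted_form)
  have frame: "frame (subfield_ring F) A_f n w"
    by (rule A_f.indexed_basis_imp_frame[OF basis])
  then obtain x where x: "x \<in> {..<n} \<rightarrow> F" "v = lin_comb A_f n x w"
    using v unfolding frame_def by auto
  have w: "w \<in> {..<n} \<rightarrow> carrier A_f" using frame by (simp add: frame_def)
  have eqs: "add A_f = add T" "ring.zero A_f = ring.zero T" "smult A_f = smult T"
    by (simp_all add: twisted_form_def)
  \<comment> \<open>The two sums are formed in records with different carriers; the inclusion, as an
    additive map, identifies them.\<close>
  have "lin_comb A_f n x w = lin_comb T n x w"
    unfolding lin_comb_def eqs
    by (rule finsum_additive(2)[of A_f T "carrier A_f" "\<lambda>z. z"])
      (use x w twisted_form_closed twisted_form_alt(2) in \<open>auto simp: eqs Pi_iff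
        intro: A_f.abelian_monoid_axioms T.abelian_monoid_axioms\<close>)
  then show ?thesis using x by auto
qed

end

end

theorem proposition2p3:
  fixes F C :: "'k::field set"
    and d D :: "'k \<Rightarrow> 'k"
    and A :: "('k, 'a) module"
    and n :: nat
    and e :: "nat \<Rightarrow> 'a"
    and f :: "('k \<Rightarrow> 'k) \<Rightarrow> (('a \<times> 'k) \<Rightarrow>\<^sub>0 int) set \<Rightarrow> (('a \<times> 'k) \<Rightarrow>\<^sub>0 int) set"
    and P :: "'k mat"
  assumes "subfield F (class_ring :: 'k ring)"
    and "derivation (subfield_ring F) d"
    and "C = {x \<in> F. d x = 0}"
    and "separable_closure_of F"
    and "derivation (class_ring :: 'k ring) D"
    and "\<forall>x\<in>F. D x = d x"
    and "assoc_algebra (subfield_ring C) A"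
    and "indexed_basis (subfield_ring C) A n e"
    and "smooth_aut_scheme TYPE('k) (subfield_ring C) A"
    and "one_cocycle F C A f"
    and "P \<in> carrier_mat n n"
    and "invertible_mat P"
    and "\<forall>i<n. mat_column (scalar_ext C A) n (mat_inv P) (basis_column C A e) i
               \<in> carrier (twisted_form F C A f)"
    and "indexed_basis (subfield_ring F) (twisted_form F C A f) n
           (mat_column (scalar_ext C A) n (mat_inv P) (basis_column C A e))"
  shows "\<exists>h. bij_betw h (derivations_extending F d (twisted_form F C A f))
    ({mat_inv P * M * P + map_mat D (mat_inv P) * P | M. M \<in> lie_algebra C A n e}
       \<inter> {N \<in> carrier_mat n n. elements_mat N \<subseteq> F})"
proof -
  let ?Q = "mat_inv P" and ?A_f = "twisted_form F C A f"
  have D_add: "D (x + y) = D x + D y" and D_mult: "D (x * y) = D x * y + x * D y" for x y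
    using assms(5) by (simp_all add: derivation_def)
  have D_F: "D x \<in> F" if "x \<in> F" for x
    using assms(2,6) that by (auto simp: derivation_def)
  have C_eq: "C = {x \<in> F. D x = 0}" using assms(3,6) by auto
  have C: "subfield C (class_ring :: 'k ring)"
    unfolding C_eq using assms(1) D_add D_mult by (rule subfield_constants)
  have "vectorspace (subfield_ring C) A"
    using field_subfield_ring[OF C] assms(7) by (simp add: vectorspace_def assoc_algebra_def)
  then have "frame (subfield_ring C) A n e"
    using assms(8) by (rule vectorspace.indexed_basis_imp_frame)
  then interpret scalar_extension C A n e
    by (rule scalar_extension.intro[OF C assms(7)])
  \<comment> \<open>\<open>D\<close> is \<open>C\<close>-linear because it kills \<open>C\<close>,
    which is what lets it induce a map on the tensor product.\<close>
  have D_C: "D (r * x) = r * D x" if "r \<in> C" for r x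
    using that by (simp add: C_eq D_mult)
  have CF: "C \<subseteq> F" by (auto simp: C_eq)
  have f: "f \<in> galois_group F \<rightarrow> aut_points (subfield_ring C) A class_algebra"
    using assms(10) by (simp add: one_cocycle_def)
  let ?W = "mat_column T n ?Q V"
  note Q = mat_inv_props[OF assms(11,12)]
  note form = twisted_form_closed[OF assms(1) CF f]
  interpret descent T F D "carrier ?A_f" n ?W
  proof
    show "frame class_ring T n ?W"
      by (rule K.frame_mat_column[OF frame_V assms(11) Q])
    show "?W \<in> {..<n} \<rightarrow> carrier ?A_f" using assms(13) by auto
    show "\<exists>x\<in>{..<n} \<rightarrow> F. v = lin_comb T n x ?W" if "v \<in> carrier ?A_f" for v
      using twisted_form_span[OF assms(1) CF f assms(14) that] .
    show "carrier ?A_f \<subseteq> carrier T" by (auto simp: twisted_form_def)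
  qed (fact D_add D_mult D_F form)+
  have form_eq: "B_alg = ?A_f"
    by (rule twisted_form_alt(1)[OF assms(1) CF f, symmetric])
  \<comment> \<open>The condition on an extending derivation looks at scalars in \<open>F\<close>
    only, where \<open>d\<close> and \<open>D\<close> agree.\<close>
  have der: "derivations_extending F d ?A_f = derivations_extending F D B_alg"
    unfolding form_eq derivations_extending_def using assms(6)
    by (intro Collect_cong conj_cong refl ball_cong) simp
  have lie: "lie_algebra C A n e = linear_derivation_matrices T n V"
    unfolding lie_algebra_def linear_derivation_matrices_def by (rule refl)
  show ?thesis
    unfolding der lie
    \<comment> \<open>The map \<open>id \<otimes> D\<close> is supplied for
      \<open>d0\<close>.\<close>
    by (rule exI, rule bij_betw_derivation_matrix[OF
        semilinear_derivation_tensor_map[OF D_add D_C D_mult] V_closed assms(11) Q refl])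
qed

end
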